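(* Let $\Omega\subset\mathbb{R}^2$ be a nonempty bounded, open, convex set. Assume that $\Omega$ is symmetric with respect to the perpendicular bisector of one of its diameters (a segment of length $D_\Omega$ with endpoints in $\overline{\Omega}$) and also with respect to a line orthogonal to that bisector. Then $$D_\Omega^2\,\mu_1(\Omega)\le 4j_{0,1}^2-0.108\,\frac{w_\Omega^2}{D_\Omega^2},$$ where $w_\Omega$ is the width of $\Omega$ in the direction orthogonal to that diameter.
   Context: For a bounded open convex set $\Omega\subset\mathbb{R}^2$, $\mu_1(\Omega)$ is the first nonzero eigenvalue of the Neumann Laplacian on $\Omega$: $$\mu_1(\Omega)=\min\left\{\frac{\int_\Omega|\nabla u|^2\,dx}{\int_\Omega u^2\,dx}: u\in H^1(\Omega)\setminus\{0\},\ \int_\Omega u\,dx=0\right\}.$$ $D_\Omega=\sup_{x,y\in\Omega}|x-y|$ is the diameter. The width of $\Omega$ in the direction of a unit vector $e$ is $\sup_{x\in\Omega}x\cdot e-\inf_{x\in\Omega}x\cdot e$. $j_{0,1}$ is the first positive zero of the Bessel function $J_0$. *)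

theory Defs
  imports "HOL-Analysis.Analysis"
begin

primrec C_k :: "nat \<Rightarrow> ('a::euclidean_space \<Rightarrow> real) \<Rightarrow> bool" where
  "C_k 0 f \<longleftrightarrow> continuous_on UNIV f"
| "C_k (Suc k) f \<longleftrightarrow> (\<forall>x. f differentiable (at x)) \<and>
     (\<forall>b\<in>Basis. C_k k (\<lambda>x. frechet_derivative f (at x) b))"

definition test_function :: "'a::euclidean_space set \<Rightarrow> ('a \<Rightarrow> real) \<Rightarrow> bool" where
  "test_function \<Omega> \<phi> \<longleftrightarrow> (\<forall>k. C_k k \<phi>) \<and>
     compact (closure {x. \<phi> x \<noteq> 0}) \<and> closure {x. \<phi> x \<noteq> 0} \<subseteq> \<Omega>"

definition in_L2 :: "'a::euclidean_space set \<Rightarrow> ('a \<Rightarrow> 'b::euclidean_space) \<Rightarrow> bool" where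
  "in_L2 \<Omega> f \<longleftrightarrow> f \<in> borel_measurable (lebesgue_on \<Omega>) \<and>
     integrable (lebesgue_on \<Omega>) (\<lambda>x. (norm (f x))\<^sup>2)"

definition weak_gradient :: "'a::euclidean_space set \<Rightarrow> ('a \<Rightarrow> real) \<Rightarrow> ('a \<Rightarrow> 'a) \<Rightarrow> bool" where
  "weak_gradient \<Omega> u g \<longleftrightarrow> (\<forall>\<phi>. test_function \<Omega> \<phi> \<longrightarrow> (\<forall>b\<in>Basis.
     integral\<^sup>L (lebesgue_on \<Omega>) (\<lambda>x. u x * frechet_derivative \<phi> (at x) b)
       = - integral\<^sup>L (lebesgue_on \<Omega>) (\<lambda>x. (g x \<bullet> b) * \<phi> x)))"

text \<open>The function \<open>u\<close> belongs to \<open>H\<^sup>1(\<Omega>)\<close> and \<open>g\<close> represents its gradient. Both represent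
  classes modulo equality almost everywhere, and the class of \<open>g\<close> is determined by that of \<open>u\<close>.\<close>

definition H1_with_gradient :: "'a::euclidean_space set \<Rightarrow> ('a \<Rightarrow> real) \<Rightarrow> ('a \<Rightarrow> 'a) \<Rightarrow> bool" where
  "H1_with_gradient \<Omega> u g \<longleftrightarrow> in_L2 \<Omega> u \<and> in_L2 \<Omega> g \<and> weak_gradient \<Omega> u g"

text \<open>The minimum of the Rayleigh quotient over the functions of mean zero that are nonzero in
  \<open>H\<^sup>1(\<Omega>)\<close>. It is written as an infimum, which is the minimum whenever the minimum is attained,
  as it is for bounded open convex \<open>\<Omega>\<close>.\<close>

definition neumann_mu1 :: "'a::euclidean_space set \<Rightarrow> real" where
  "neumann_mu1 \<Omega> = Inf {integral\<^sup>L (lebesgue_on \<Omega>) (\<lambda>x. (norm (g x))\<^sup>2)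
                          / integral\<^sup>L (lebesgue_on \<Omega>) (\<lambda>x. (u x)\<^sup>2) | u g.
     H1_with_gradient \<Omega> u g \<and> \<not> (AE x in lebesgue_on \<Omega>. u x = 0) \<and>
     integral\<^sup>L (lebesgue_on \<Omega>) u = 0}"

definition bessel_J0 :: "real \<Rightarrow> real" where
  "bessel_J0 x = (\<Sum>k. (-1) ^ k / (fact k)\<^sup>2 * (x / 2) ^ (2 * k))"

definition j01 :: real where
  "j01 = (LEAST x. 0 < x \<and> bessel_J0 x = 0)"

definition width :: "'a::euclidean_space set \<Rightarrow> 'a \<Rightarrow> real" where
  "width S e = (SUP x\<in>S. x \<bullet> e) - (INF x\<in>S. x \<bullet> e)"

text \<open>Reflection across the hyperplane (in the plane: the line) through \<open>p\<close> with normal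
  vector \<open>n \<noteq> 0\<close>; \<open>n\<close> need not be a unit vector.\<close>

definition reflection :: "'a::euclidean_space \<Rightarrow> 'a \<Rightarrow> 'a \<Rightarrow> 'a" where
  "reflection p n x = x - (2 * ((x - p) \<bullet> n) / (n \<bullet> n)) *\<^sub>R n"

definition symmetric_about :: "'a::euclidean_space set \<Rightarrow> 'a \<Rightarrow> 'a \<Rightarrow> bool" where
  "symmetric_about S p n \<longleftrightarrow> reflection p n ` S = S"

end

theory Submission
  imports Defs
begin

text \<open>
  Put the diameter on the segment from \<open>(-1, 0)\<close> to \<open>(1, 0)\<close>, so that the domain becomes a convex
  set \<open>W\<close> that is symmetric in both coordinates and has half-width \<open>H = w / D\<close>. With
  \<open>j = j01\<close> and \<open>F(s) = sgn s * J0(j (1 - |s|))\<close>, the trial function is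
  \<open>u(s, t) = F(s) (1 - t\<^sup>2/3)\<close>; it is odd in \<open>s\<close>, hence of mean zero, and of class \<open>C\<^sup>1\<close>.
  The factor \<open>F\<close> is the extremal function of the one-dimensional problem with weight \<open>1 - |s|\<close>,
  that is, of an infinitely thin rhombus, where \<open>D\<^sup>2\<close> times its
  Rayleigh quotient is exactly \<open>4 j\<^sup>2\<close>. The factor
  \<open>1 - t\<^sup>2/3\<close> gains a multiple of the second moment of \<open>u\<close> in the direction \<open>t\<close>.

  On the half \<open>s > 0\<close> let \<open>r = 1 - s\<close>, \<open>f(r) = J0(j r)\<close> and \<open>q = (1 - t\<^sup>2/3)\<^sup>2\<close>. On each ray
  \<open>t = r z\<close> from the vertex \<open>(1, 0)\<close>, Bessel's equation \<open>(r f')' = - j\<^sup>2 r f\<close> turns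
  \<open>r q (f'\<^sup>2 - j\<^sup>2 f\<^sup>2)\<close> into the derivative of \<open>r q f f'\<close> minus \<open>r (dq/dr) f f'\<close>.
  The half domain is star-shaped about the vertex and \<open>f f' \<le> 0\<close>, so the boundary term has a sign.
  The remaining term, \<open>dq/dr\<close> being negative, dominates the energy \<open>(4/9) t\<^sup>2 f\<^sup>2\<close> of the \<open>t\<close>-derivative
  because \<open>- f' \<ge> (j\<^sup>2/2) r f\<close> and \<open>j\<^sup>2 \<ge> 4\<close>. What is left is
  \<open>\<integral> |\<nabla>u|\<^sup>2 - j\<^sup>2 u\<^sup>2 \<le> - (4/3) \<integral> t\<^sup>2 f\<^sup>2\<close> over the half domain (\<open>radial_estimate\<close>). Rays are never used
  explicitly: the sign of the boundary term is read off by differentiating an integral over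
  dilated copies of the set (\<open>integral_dilation_generator_nonpos\<close>).

  The second moment is compared with \<open>\<integral> f\<^sup>2\<close> on vertical slices (\<open>second_moment_estimate\<close>). A slice has
  the form \<open>|t| < h(s)\<close> with \<open>h(s) \<ge> H (1 - s)\<close> and \<open>h\<close> decreasing, hence its second moment is at least
  \<open>(2/3) h(s) H\<^sup>2 (1 - s)\<^sup>2\<close>, and a one-dimensional integral of \<open>f\<^sup>2\<close> (\<open>weighted_moment_nonneg\<close>)
  gives \<open>\<integral> t\<^sup>2 f\<^sup>2 \<ge> (H\<^sup>2/48) \<integral> f\<^sup>2\<close>. As \<open>u\<^sup>2 \<le> f\<^sup>2\<close>, the gain in the Rayleigh quotient
  is at least \<open>H\<^sup>2/36\<close>; multiplied by \<open>4\<close>, which comes from \<open>D = 2\<close>, this is \<open>H\<^sup>2/9 \<ge> 0.108 H\<^sup>2\<close>.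

  The trial function is admissible in the weak formulation by \<open>neumann_mu1_test_function\<close>.
\<close>

section \<open>Integrals over bounded sets and changes of variables\<close>

lemma integrable_bounded_set:
  fixes f :: "'a::euclidean_space \<Rightarrow> real"
  assumes "S \<in> sets borel" "bounded S" "continuous_on UNIV f"
  shows "integrable lborel (\<lambda>x. indicator S x * f x)"
proof -
  obtain R where R: "S \<subseteq> cball 0 R" using assms(2) by (auto simp: bounded_iff subset_iff)
  have "integrable lborel (\<lambda>x. indicator (cball 0 R) x *\<^sub>R f x)"
    by (rule borel_integrable_compact) (auto intro!: continuous_on_subset[OF assms(3)])
  from integrable_mult_indicator[OF _ this, of S] assms(1)
  have "integrable lborel (\<lambda>x. indicator S x *\<^sub>R (indicator (cball 0 R) x *\<^sub>R f x))"
    by simp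
  moreover have "(\<lambda>x. indicator S x *\<^sub>R (indicator (cball 0 R) x *\<^sub>R f x)) = (\<lambda>x. indicator S x * f x)"
    using R by (auto simp: fun_eq_iff indicator_def)
  ultimately show ?thesis by simp
qed

lemma integrable_continuous_zero_outside:
  fixes f :: "'a::euclidean_space \<Rightarrow> real"
  assumes "continuous_on UNIV f" and "\<And>x. x \<notin> cball 0 R \<Longrightarrow> f x = 0"
  shows "integrable lborel f"
proof -
  have "integrable lborel (\<lambda>x. indicator (cball 0 R) x * f x)"
    using assms(1) by (intro integrable_bounded_set) auto
  moreover have "(\<lambda>x. indicator (cball 0 R) x * f x) = f"
    using assms(2) by (auto simp: fun_eq_iff indicator_def)
  ultimately show ?thesis by simp
qed

text \<open>The computations below are integrals over the whole space against \<open>lborel\<close>; this is the passage to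
  them from the integrals in the definition of the eigenvalue.\<close>

lemma integral_lebesgue_on_eq:
  fixes f :: "'a::euclidean_space \<Rightarrow> real"
  assumes "S \<in> sets borel" "f \<in> borel_measurable borel"
  shows "integral\<^sup>L (lebesgue_on S) f = (\<integral>x. indicator S x * f x \<partial>lborel)"
proof -
  have "integral\<^sup>L (lebesgue_on S) f = (\<integral>x. indicator S x *\<^sub>R f x \<partial>lebesgue)"
    using assms by (intro integral_restrict_space) auto
  also have "\<dots> = (\<integral>x. indicator S x *\<^sub>R f x \<partial>lborel)"
    using assms by (intro integral_completion) simp
  finally show ?thesis by simp
qed

text \<open>The value of \<open>K\<close> is the area of the rectangle spanned by \<open>v\<close> and \<open>w\<close>. It is left unspecified,
  because it cancels in a Rayleigh quotient. The proof passes through the standard coordinates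
  of \<open>real ^ 2\<close>: the product measure is transported there by comparing boxes, and then by a linear map
  whose effect on measure is its determinant.\<close>

lemma integral_orthogonal_coordinates:
  fixes v w m :: "real ^ 2"
  assumes "v \<bullet> w = 0" "v \<noteq> 0" "w \<noteq> 0"
  obtains K where "0 < K" "\<And>g :: real ^ 2 \<Rightarrow> real. g \<in> borel_measurable borel \<Longrightarrow>
    integral\<^sup>L lborel g = K * (\<integral>z. g (m + fst z *\<^sub>R v + snd z *\<^sub>R w) \<partial>lborel)"
proof -
  define S :: "real \<times> real \<Rightarrow> real ^ 2" where "S z = fst z *\<^sub>R axis 1 1 + snd z *\<^sub>R axis 2 1" for z
  have S_nth [simp]: "S z $ 1 = fst z" "S z $ 2 = snd z" for z by (simp_all add: S_def axis_def)
  have "continuous_on UNIV S"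
    unfolding S_def by (intro continuous_intros)
  then have S_m [measurable]: "S \<in> borel_measurable borel" by (rule borel_measurable_continuous_onI)
  have S_lborel: "lborel = distr lborel borel S"
  proof (rule lborel_eqI)
    fix l u :: "real ^ 2" assume lu: "\<And>b. b \<in> Basis \<Longrightarrow> l \<bullet> b \<le> u \<bullet> b"
    have le: "l $ i \<le> u $ i" for i
      using lu[of "axis i 1"] by (simp add: inner_axis axis_in_Basis_iff)
    have "S -` box l u = box (l $ 1, l $ 2) (u $ 1, u $ 2)"
      by (auto simp: mem_box_cart forall_2 mem_box Basis_prod_def)
    then have "emeasure (distr lborel borel S) (box l u) = emeasure lborel (box (l $ 1, l $ 2) (u $ 1, u $ 2))"
      by (simp add: emeasure_distr)
    also have "\<dots> = ennreal (\<Prod>b\<in>Basis. ((u $ 1, u $ 2) - (l $ 1, l $ 2)) \<bullet> b)"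
      by (rule emeasure_lborel_box) (use le in \<open>auto simp: Basis_prod_def\<close>)
    also have "(\<Prod>b\<in>Basis. ((u $ 1, u $ 2) - (l $ 1, l $ 2)) \<bullet> b) = (\<Prod>b\<in>Basis. (u - l) \<bullet> b)"
    proof -
      have 1: "(\<Prod>b\<in>Basis. (u - l) \<bullet> b) = (u $ 1 - l $ 1) * (u $ 2 - l $ 2)"
        by (simp add: Basis_vec_def inner_axis UNIV_2 axis_eq_axis)
      show ?thesis unfolding 1 by (simp add: Basis_prod_def)
    qed
    finally show "emeasure (distr lborel borel S) (box l u) = ennreal (\<Prod>b\<in>Basis. (u - l) \<bullet> b)" .
  qed simp
  define f :: "real ^ 2 \<Rightarrow> real ^ 2" where "f x = x $ 1 *\<^sub>R v + x $ 2 *\<^sub>R w" for x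
  have lin: "linear f"
    by (rule linearI) (simp_all add: f_def algebra_simps)
  then have f_m [measurable]: "f \<in> borel_measurable borel"
    by (simp add: borel_measurable_continuous_onI linear_continuous_on linear_conv_bounded_linear)
  have inj: "inj f"
  proof -
    have "x = 0" if "f x = 0" for x
    proof -
      have "f x \<bullet> v = 0" "f x \<bullet> w = 0" using that by simp_all
      then have "x $ 1 * (v \<bullet> v) = 0" "x $ 2 * (w \<bullet> w) = 0"
        using assms(1) by (simp_all add: f_def inner_add_left inner_commute[of w v])
      then have "x $ 1 = 0" "x $ 2 = 0" using assms(2,3) by auto
      then show ?thesis by (simp add: vec_eq_iff forall_2)
    qed
    then show ?thesis using lin by (simp add: linear_injective_0)
  qed
  define K where "K = \<bar>det (matrix f)\<bar>"
  have "0 < K" using inj lin by (simp add: K_def det_nz_iff_inj)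
  obtain h where h: "linear h" "\<And>x. h (f x) = x" "\<And>x. f (h x) = x"
    using linear_injective_isomorphism[OF lin inj] by auto
  have f_lborel: "lborel = density (distr lborel borel f) (\<lambda>_. ennreal K)"
  proof (rule lborel_eqI)
    fix l u :: "real ^ 2" assume le: "\<And>b. b \<in> Basis \<Longrightarrow> l \<bullet> b \<le> u \<bullet> b"
    define A where "A = f -` box l u"
    have "A = h ` box l u"
      unfolding A_def by (auto simp: h(3)) (metis h(2) image_eqI)
    then have "bounded A"
      using h(1) by (simp add: bounded_linear_image linear_conv_bounded_linear)
    moreover have "open A" unfolding A_def
      using lin by (intro open_vimage) (auto simp: linear_continuous_on linear_conv_bounded_linear)
    ultimately have A: "A \<in> lmeasurable" "A \<in> sets borel"
      by (auto intro: lmeasurable_open)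
    have fA: "f ` A = box l u" unfolding A_def
      by (rule surj_image_vimage_eq) (metis h(3) surjI)
    have "emeasure (density (distr lborel borel f) (\<lambda>_. ennreal K)) (box l u)
        = ennreal K * emeasure lborel A"
      by (simp add: emeasure_density nn_integral_cmult emeasure_distr A_def)
    also have "emeasure lborel A = emeasure lebesgue A" using A by simp
    also have "\<dots> = ennreal (measure lebesgue A)"
      by (rule emeasure_eq_measure2[OF A(1)])
    also have "ennreal K * \<dots> = ennreal (K * measure lebesgue A)"
      using \<open>0 < K\<close> by (simp add: ennreal_mult)
    also have "K * measure lebesgue A = measure lebesgue (box l u)"
      using measure_linear_image[OF lin A(1)] by (simp add: K_def fA)
    also have "\<dots> = (\<Prod>b\<in>Basis. (u - l) \<bullet> b)"
      using le by (simp add: measure_completion measure_lborel_box_eq)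
    finally show "emeasure (density (distr lborel borel f) (\<lambda>_. ennreal K)) (box l u)
        = ennreal (\<Prod>b\<in>Basis. (u - l) \<bullet> b)" .
  qed simp
  have "integral\<^sup>L lborel g = K * (\<integral>z. g (m + fst z *\<^sub>R v + snd z *\<^sub>R w) \<partial>lborel)"
    if g [measurable]: "g \<in> borel_measurable borel" for g :: "real ^ 2 \<Rightarrow> real"
  proof -
    have "integral\<^sup>L lborel g = integral\<^sup>L (distr lborel borel ((+) m)) g"
      by (simp add: lborel_distr_plus)
    also have "\<dots> = (\<integral>x. g (m + x) \<partial>lborel)"
      by (subst integral_distr) auto
    also have "\<dots> = K * (\<integral>x. g (m + f x) \<partial>lborel)"
      using \<open>0 < K\<close> by (subst f_lborel) (simp add: integral_density integral_distr)
    also have "(\<integral>x. g (m + f x) \<partial>lborel) = (\<integral>z. g (m + f (S z)) \<partial>lborel)"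
      by (subst S_lborel) (simp add: integral_distr)
    finally show ?thesis by (simp add: f_def add.assoc)
  qed
  with \<open>0 < K\<close> show ?thesis by (rule that)
qed


lemma integral_reflect_fst:
  fixes g :: "real \<times> real \<Rightarrow> real"
  assumes [measurable]: "g \<in> borel_measurable borel"
  shows "(\<integral>z. g (- fst z, snd z) \<partial>lborel) = integral\<^sup>L lborel g"
proof -
  define c :: "real \<times> real \<Rightarrow> real" where "c j = (if j = (1, 0) then -1 else 1)" for j
  have T: "0 + (\<Sum>j\<in>Basis. (c j * (z \<bullet> j)) *\<^sub>R j) = (- fst z, snd z)" for z :: "real \<times> real"
    by (cases z) (simp add: Basis_prod_def c_def)
  have "(\<Prod>j\<in>Basis. \<bar>c j\<bar>) = 1" by (rule prod.neutral) (simp add: c_def)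
  moreover have "(lborel :: (real \<times> real) measure) = density
      (distr lborel borel (\<lambda>z. 0 + (\<Sum>j\<in>Basis. (c j * (z \<bullet> j)) *\<^sub>R j))) (\<lambda>_. (\<Prod>j\<in>Basis. \<bar>c j\<bar>))"
    by (rule lborel_affine_euclidean) (simp add: c_def)
  ultimately have "(lborel :: (real \<times> real) measure) = distr lborel borel (\<lambda>z. (- fst z, snd z))"
    by (simp only: T ennreal_1 density_1)
  then have "integral\<^sup>L lborel g = integral\<^sup>L (distr lborel borel (\<lambda>z. (- fst z, snd z))) g"
    by simp
  also have "\<dots> = (\<integral>z. g (- fst z, snd z) \<partial>lborel)"
    by (subst integral_distr)
       (auto intro!: borel_measurable_continuous_onI continuous_intros)
  finally show ?thesis by simp
qed

lemma fubini_real2: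
  fixes g :: "real \<times> real \<Rightarrow> real"
  assumes "integrable lborel g"
  shows "integrable lborel (\<lambda>s. \<integral>t. g (s, t) \<partial>lborel)"
    and "integral\<^sup>L lborel g = (\<integral>s. \<integral>t. g (s, t) \<partial>lborel \<partial>lborel)"
proof -
  have "integrable (lborel \<Otimes>\<^sub>M lborel) g" using assms by (simp add: lborel_prod)
  from lborel_pair.integrable_fst'[OF this] lborel_pair.integral_fst'[OF this]
  show "integrable lborel (\<lambda>s. \<integral>t. g (s, t) \<partial>lborel)"
    "integral\<^sup>L lborel g = (\<integral>s. \<integral>t. g (s, t) \<partial>lborel \<partial>lborel)"
    by (simp_all add: lborel_prod)
qed

section \<open>Continuously differentiable trial functions\<close>

text \<open>This form feeds the one-dimensional mean value theorem.\<close>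

lemma DERIV_along_line:
  fixes f :: "'a::euclidean_space \<Rightarrow> real"
  assumes "\<And>x. (f has_derivative f' x) (at x)"
  shows "((\<lambda>t. f (x + t *\<^sub>R b)) has_real_derivative f' (x + t *\<^sub>R b) b) (at t)"
proof -
  have lin: "bounded_linear (f' (x + t *\<^sub>R b))"
    using assms has_derivative_bounded_linear by blast
  have "((\<lambda>t. f (x + t *\<^sub>R b)) has_derivative (\<lambda>h. f' (x + t *\<^sub>R b) (h *\<^sub>R b))) (at t)"
    by (rule has_derivative_compose[of "\<lambda>t. x + t *\<^sub>R b" _ _ _ f, OF _ assms])
       (auto intro!: derivative_eq_intros)
  moreover have "(\<lambda>h. f' (x + t *\<^sub>R b) (h *\<^sub>R b)) = (*) (f' (x + t *\<^sub>R b) b)"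
    using lin by (auto simp: fun_eq_iff linear_cmul bounded_linear.linear)
  ultimately show ?thesis by (simp add: has_field_derivative_def)
qed

text \<open>By translation invariance the difference quotients of \<open>f\<close> in the direction \<open>b\<close> have integral zero.
  They converge to the derivative and are dominated by a constant on a fixed ball, so the limit
  has integral zero as well. This replaces integration by parts.\<close>

lemma integral_directional_derivative_eq_0:
  fixes f :: "'a::euclidean_space \<Rightarrow> real"
  assumes der: "\<And>x. (f has_derivative f' x) (at x)"
    and cont: "continuous_on UNIV (\<lambda>x. f' x b)"
    and supp: "bounded {x. f x \<noteq> 0}"
  shows "(\<integral>x. f' x b \<partial>lborel) = 0"
proof -
  obtain R where R: "0 < R" "\<And>x. f x \<noteq> 0 \<Longrightarrow> norm x \<le> R"
    using supp unfolding bounded_pos by auto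
  have contf: "continuous_on UNIV f"
    by (meson der continuous_at_imp_continuous_on has_derivative_continuous)
  have intf: "integrable lborel f"
    using R(2) by (intro integrable_continuous_zero_outside[OF contf, of R]) force
  \<comment> \<open>A quotient with step at most \<open>1\<close> vanishes unless \<open>norm x \<le> R + norm b\<close>, and then the intermediate
    point of the mean value theorem lies in \<open>B\<close>.\<close>
  define B where "B = cball (0::'a) (R + 2 * norm b)"
  have "bounded ((\<lambda>x. f' x b) ` B)"
    by (rule compact_imp_bounded, rule compact_continuous_image)
       (auto simp: B_def intro: continuous_on_subset[OF cont])
  then obtain C where C: "0 < C" "\<And>x. x \<in> B \<Longrightarrow> \<bar>f' x b\<bar> \<le> C"
    unfolding bounded_pos by (force simp: B_def)
  define t :: "nat \<Rightarrow> real" where "t n = 1 / real (Suc n)" for n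
  have t: "0 < t n" "t n \<le> 1" for n by (auto simp: t_def)
  have t0: "t \<longlonglongrightarrow> 0" unfolding t_def using LIMSEQ_inverse_real_of_nat
    by (simp add: inverse_eq_divide)
  define q where "q n x = (f (x + t n *\<^sub>R b) - f x) / t n" for n x
  have int_shift: "integrable lborel (\<lambda>x. f (x + c))" "(\<integral>x. f (x + c) \<partial>lborel) = integral\<^sup>L lborel f" for c
  proof -
    have "integrable (distr lborel borel ((+) c)) f"
      using intf by (simp add: lborel_distr_plus)
    then show "integrable lborel (\<lambda>x. f (x + c))"
      using intf by (subst (asm) integrable_distr_eq) (auto simp: add.commute)
    have "integral\<^sup>L (distr lborel borel ((+) c)) f = integral\<^sup>L lborel f"
      by (simp add: lborel_distr_plus)
    then show "(\<integral>x. f (x + c) \<partial>lborel) = integral\<^sup>L lborel f"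
      using intf by (subst (asm) integral_distr) (auto simp: add.commute)
  qed
  have q0: "integral\<^sup>L lborel (q n) = 0" for n
    unfolding q_def using int_shift intf by simp
  have "(\<lambda>n. integral\<^sup>L lborel (q n)) \<longlonglongrightarrow> (\<integral>x. f' x b \<partial>lborel)"
  proof (rule integral_dominated_convergence[where w = "\<lambda>x. indicator B x * C"])
    show "(\<lambda>x. f' x b) \<in> borel_measurable lborel"
      using cont by (simp add: borel_measurable_continuous_onI)
    show "q n \<in> borel_measurable lborel" for n
      unfolding q_def using int_shift(1) intf by (intro borel_measurable_integrable) auto
    show "integrable lborel (\<lambda>x. indicator B x * C)"
      by (intro integrable_mult_left integrable_real_indicator)
         (simp_all add: B_def emeasure_bounded_finite[unfolded infinity_ennreal_def])
    show "AE x in lborel. (\<lambda>n. q n x) \<longlonglongrightarrow> f' x b"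
    proof (rule AE_I2)
      fix x
      have "((\<lambda>h. (f (x + h *\<^sub>R b) - f x) / h) \<longlongrightarrow> f' x b) (at 0)"
        using DERIV_along_line[OF der, of x b 0] by (simp add: DERIV_def)
      then show "(\<lambda>n. q n x) \<longlonglongrightarrow> f' x b"
        unfolding q_def by (rule filterlim_compose)
          (use t0 t(1) in \<open>auto simp: filterlim_at less_imp_neq[symmetric]\<close>)
    qed
    show "AE x in lborel. norm (q n x) \<le> indicator B x * C" for n
    proof (rule AE_I2)
      fix x
      show "norm (q n x) \<le> indicator B x * C"
      proof (cases "norm x \<le> R + norm b")
        case True
        obtain z where z: "0 < z" "z < t n" "f (x + t n *\<^sub>R b) - f (x + 0 *\<^sub>R b)
            = (t n - 0) * f' (x + z *\<^sub>R b) b"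
          using MVT2[of 0 "t n" "\<lambda>t. f (x + t *\<^sub>R b)" "\<lambda>t. f' (x + t *\<^sub>R b) b"]
            t(1) DERIV_along_line[OF der, of x b] by blast
        have "norm (z *\<^sub>R b) \<le> 1 * norm b"
          unfolding norm_scaleR by (rule mult_right_mono) (use z t(2)[of n] in auto)
        then have "norm (x + z *\<^sub>R b) \<le> R + 2 * norm b"
          using norm_triangle_ineq[of x "z *\<^sub>R b"] True by linarith
        then have "\<bar>f' (x + z *\<^sub>R b) b\<bar> \<le> C" by (intro C) (simp add: B_def)
        moreover have "q n x = f' (x + z *\<^sub>R b) b" using z(3) t(1)[of n] by (simp add: q_def)
        moreover have "x \<in> B" using True norm_ge_zero[of b] unfolding B_def mem_cball_0 by linarith
        ultimately show ?thesis by simp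
      next
        case False
        have "norm (t n *\<^sub>R b) \<le> 1 * norm b"
          unfolding norm_scaleR by (rule mult_right_mono) (use t[of n] in auto)
        moreover have "norm x \<le> norm (x + t n *\<^sub>R b) + norm (t n *\<^sub>R b)"
          using norm_triangle_ineq4[of "x + t n *\<^sub>R b" "t n *\<^sub>R b"] by (simp del: norm_scaleR)
        ultimately have "\<not> norm (x + t n *\<^sub>R b) \<le> R" "\<not> norm x \<le> R"
          using False norm_ge_zero[of b] by linarith+
        then have "f (x + t n *\<^sub>R b) = 0" "f x = 0" using R(2) by blast+
        then have "q n x = 0" by (simp add: q_def)
        then show ?thesis using C(1) by (simp add: indicator_def)
      qed
    qed
  qed
  then show ?thesis by (simp add: q0 LIMSEQ_const_iff)
qed

text \<open>The product of \<open>u\<close> with a test function has compact support, and the integral of each of its partial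
  derivatives vanishes. The product rule then gives the weak formulation.\<close>

lemma C1_imp_weak_gradient:
  fixes u :: "'a::euclidean_space \<Rightarrow> real"
  assumes "open S"
    and der: "\<And>x. (u has_derivative (\<lambda>h. g x \<bullet> h)) (at x)"
    and cont: "continuous_on UNIV g"
  shows "weak_gradient S u g"
  unfolding weak_gradient_def
proof (intro allI impI ballI)
  fix p :: "'a \<Rightarrow> real" and b :: 'a
  assume p: "test_function S p" and b: "b \<in> Basis"
  define p' where "p' x = frechet_derivative p (at x)" for x
  have C1: "C_k (Suc 0) p" using p unfolding test_function_def by blast
  have derp: "(p has_derivative p' x) (at x)" for x
    using C1 by (simp add: p'_def frechet_derivative_works[symmetric])
  have contp': "continuous_on UNIV (\<lambda>x. p' x b)"
    using C1 b by (simp add: p'_def)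
  have contp: "continuous_on UNIV p"
    by (meson derp continuous_at_imp_continuous_on has_derivative_continuous)
  have contu: "continuous_on UNIV u"
    by (meson der continuous_at_imp_continuous_on has_derivative_continuous)
  define Z where "Z = closure {x. p x \<noteq> 0}"
  have Z: "compact Z" "Z \<subseteq> S" using p by (auto simp: test_function_def Z_def)
  have p0: "p x = 0" if "x \<notin> Z" for x
    using that closure_subset[of "{x. p x \<noteq> 0}"] by (auto simp: Z_def)
  have p'0: "p' x b = 0" if "x \<notin> Z" for x
  proof -
    have "open (- Z)" by (simp add: Z_def open_Compl)
    then have "((\<lambda>x. 0) has_derivative p' x) (at x)"
      by (rule has_derivative_transform_within_open[OF derp]) (use that p0 in auto)
    then have "p' x = (\<lambda>h. 0)"
      using has_derivative_unique has_derivative_const by blast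
    then show ?thesis by simp
  qed
  obtain R where R: "\<And>x. x \<in> Z \<Longrightarrow> norm x \<le> R"
    using Z(1) compact_imp_bounded bounded_iff by metis
  have int1: "integrable lborel (\<lambda>x. u x * p' x b)"
    using p'0 R by (intro integrable_continuous_zero_outside[of _ R] continuous_intros contu contp') force
  have int2: "integrable lborel (\<lambda>x. (g x \<bullet> b) * p x)"
    using p0 R by (intro integrable_continuous_zero_outside[of _ R] continuous_intros cont contp) force
  have "(\<integral>x. u x * p' x b + (g x \<bullet> b) * p x \<partial>lborel) = 0"
  proof (rule integral_directional_derivative_eq_0[where f = "\<lambda>x. u x * p x"
        and f' = "\<lambda>x h. u x * p' x h + (g x \<bullet> h) * p x"])
    show "((\<lambda>x. u x * p x) has_derivative (\<lambda>h. u x * p' x h + g x \<bullet> h * p x)) (at x)" for x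
      by (rule has_derivative_mult[OF der derp])
    show "continuous_on UNIV (\<lambda>x. u x * p' x b + g x \<bullet> b * p x)"
      by (intro continuous_intros contu contp' contp cont)
    show "bounded {x. u x * p x \<noteq> 0}"
      by (rule bounded_subset[OF compact_imp_bounded[OF Z(1)]]) (use p0 in auto)
  qed
  then have "(\<integral>x. u x * p' x b \<partial>lborel) = - (\<integral>x. (g x \<bullet> b) * p x \<partial>lborel)"
    using int1 int2 by simp
  moreover have "integral\<^sup>L (lebesgue_on S) (\<lambda>x. u x * p' x b) = (\<integral>x. u x * p' x b \<partial>lborel)"
  proof -
    have "(\<lambda>x. indicator S x * (u x * p' x b)) = (\<lambda>x. u x * p' x b)"
      using p'0 Z(2) by (auto simp: fun_eq_iff indicator_def)
    then show ?thesis using int1 assms(1) by (subst integral_lebesgue_on_eq) auto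
  qed
  moreover have "integral\<^sup>L (lebesgue_on S) (\<lambda>x. (g x \<bullet> b) * p x) = (\<integral>x. (g x \<bullet> b) * p x \<partial>lborel)"
  proof -
    have "(\<lambda>x. indicator S x * ((g x \<bullet> b) * p x)) = (\<lambda>x. (g x \<bullet> b) * p x)"
      using p0 Z(2) by (auto simp: fun_eq_iff indicator_def)
    then show ?thesis using int2 assms(1) by (subst integral_lebesgue_on_eq) auto
  qed
  ultimately show "integral\<^sup>L (lebesgue_on S) (\<lambda>x. u x * frechet_derivative p (at x) b)
      = - integral\<^sup>L (lebesgue_on S) (\<lambda>x. g x \<bullet> b * p x)"
    by (simp add: p'_def)
qed

lemma in_L2_continuous:
  fixes f :: "'a::euclidean_space \<Rightarrow> 'b::euclidean_space"
  assumes "S \<in> sets borel" "bounded S" "continuous_on UNIV f"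
  shows "in_L2 S f"
proof -
  have m: "f \<in> borel_measurable borel" using assms(3) by (rule borel_measurable_continuous_onI)
  have "integrable lborel (\<lambda>x. indicator S x * (norm (f x))\<^sup>2)"
    by (intro integrable_bounded_set assms(1,2) continuous_intros assms(3))
  then have "integrable lebesgue (\<lambda>x. indicator S x *\<^sub>R (norm (f x))\<^sup>2)"
    using m assms(1) by (subst integrable_completion) auto
  then have "integrable (lebesgue_on S) (\<lambda>x. (norm (f x))\<^sup>2)"
    using assms(1) by (subst integrable_restrict_space) auto
  moreover have "f \<in> borel_measurable (lebesgue_on S)"
    using m by (intro measurable_restrict_space1 measurable_completion) simp
  ultimately show ?thesis by (simp add: in_L2_def)
qed

text \<open>Continuity turns a single nonzero value in the open set into nonvanishing on a set of positive
  measure, so that the Rayleigh quotient of \<open>u\<close> is one of those in the infimum.\<close>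

lemma neumann_mu1_test_function:
  fixes u :: "'a::euclidean_space \<Rightarrow> real"
  assumes S: "open S" "bounded S"
    and der: "\<And>x. (u has_derivative (\<lambda>h. g x \<bullet> h)) (at x)"
    and cont: "continuous_on UNIV g"
    and mean: "(\<integral>x. indicator S x * u x \<partial>lborel) = 0"
    and nz: "p \<in> S" "u p \<noteq> 0"
  shows "0 < (\<integral>x. indicator S x * (u x)\<^sup>2 \<partial>lborel)"
    and "neumann_mu1 S \<le> (\<integral>x. indicator S x * (norm (g x))\<^sup>2 \<partial>lborel)
      / (\<integral>x. indicator S x * (u x)\<^sup>2 \<partial>lborel)"
proof -
  have contu: "continuous_on UNIV u"
    by (meson der continuous_at_imp_continuous_on has_derivative_continuous)
  have mu: "u \<in> borel_measurable borel" and mg: "g \<in> borel_measurable borel"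
    using contu cont by (simp_all add: borel_measurable_continuous_onI)
  have Sb: "S \<in> sets borel" using S(1) by simp
  have H1: "H1_with_gradient S u g"
    unfolding H1_with_gradient_def
    using in_L2_continuous[OF Sb S(2) contu] in_L2_continuous[OF Sb S(2) cont]
      C1_imp_weak_gradient[OF S(1) der cont] by simp
  have notAE: "\<not> (AE x in lebesgue_on S. u x = 0)"
  proof
    assume "AE x in lebesgue_on S. u x = 0"
    then have "AE x\<in>S in lebesgue. x \<in> {x. u x = 0}"
      using Sb by (subst (asm) AE_restrict_space_iff) auto
    moreover have "closed {x. u x = 0}"
      by (intro closed_Collect_eq contu continuous_on_const)
    ultimately have "p \<in> {x. u x = 0}"
      using mem_closed_if_AE_lebesgue_open[OF S(1), of "{x. u x = 0}" p] nz(1) by blast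
    then show False using nz(2) by simp
  qed
  have eq_u: "integral\<^sup>L (lebesgue_on S) (\<lambda>x. (u x)\<^sup>2) = (\<integral>x. indicator S x * (u x)\<^sup>2 \<partial>lborel)"
    using mu by (intro integral_lebesgue_on_eq Sb) simp
  have eq_g: "integral\<^sup>L (lebesgue_on S) (\<lambda>x. (norm (g x))\<^sup>2) = (\<integral>x. indicator S x * (norm (g x))\<^sup>2 \<partial>lborel)"
    using mg by (intro integral_lebesgue_on_eq Sb) simp
  show "0 < (\<integral>x. indicator S x * (u x)\<^sup>2 \<partial>lborel)"
  proof -
    have int: "integrable (lebesgue_on S) (\<lambda>x. (u x)\<^sup>2)"
      using in_L2_continuous[OF Sb S(2) contu] by (simp add: in_L2_def)
    have "integral\<^sup>L (lebesgue_on S) (\<lambda>x. (u x)\<^sup>2) \<noteq> 0"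
      using integral_nonneg_eq_0_iff_AE[OF int] notAE by simp
    moreover have "0 \<le> integral\<^sup>L (lebesgue_on S) (\<lambda>x. (u x)\<^sup>2)" by (rule integral_nonneg_AE) simp
    ultimately have "0 < integral\<^sup>L (lebesgue_on S) (\<lambda>x. (u x)\<^sup>2)" by linarith
    then show ?thesis by (simp only: eq_u)
  qed
  have "neumann_mu1 S \<le> integral\<^sup>L (lebesgue_on S) (\<lambda>x. (norm (g x))\<^sup>2)
      / integral\<^sup>L (lebesgue_on S) (\<lambda>x. (u x)\<^sup>2)"
    unfolding neumann_mu1_def
  proof (rule cInf_lower)
    show "bdd_below {integral\<^sup>L (lebesgue_on S) (\<lambda>x. (norm (g x))\<^sup>2) / integral\<^sup>L (lebesgue_on S) (\<lambda>x. (u x)\<^sup>2) |u g.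
        H1_with_gradient S u g \<and> \<not> (AE x in lebesgue_on S. u x = 0) \<and> integral\<^sup>L (lebesgue_on S) u = 0}"
      by (rule bdd_belowI[of _ 0]) (auto intro!: divide_nonneg_nonneg integral_nonneg_AE)
    have "integral\<^sup>L (lebesgue_on S) u = 0"
      using mean by (simp add: integral_lebesgue_on_eq[OF Sb mu])
    then show "integral\<^sup>L (lebesgue_on S) (\<lambda>x. (norm (g x))\<^sup>2) / integral\<^sup>L (lebesgue_on S) (\<lambda>x. (u x)\<^sup>2)
      \<in> {integral\<^sup>L (lebesgue_on S) (\<lambda>x. (norm (g x))\<^sup>2) / integral\<^sup>L (lebesgue_on S) (\<lambda>x. (u x)\<^sup>2) |u g.
        H1_with_gradient S u g \<and> \<not> (AE x in lebesgue_on S. u x = 0) \<and> integral\<^sup>L (lebesgue_on S) u = 0}"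
      using H1 notAE by blast
  qed
  then show "neumann_mu1 S \<le> (\<integral>x. indicator S x * (norm (g x))\<^sup>2 \<partial>lborel)
      / (\<integral>x. indicator S x * (u x)\<^sup>2 \<partial>lborel)"
    by (simp only: eq_u eq_g)
qed

section \<open>Star-shaped sets and dilations\<close>

text \<open>As \<open>S\<close> contains \<open>t S\<close> for \<open>t < 1\<close> and \<open>f \<le> 0\<close> on \<open>S\<close>, the integral of \<open>f\<close> over \<open>t S\<close> is at least that
  over \<open>S\<close>. A change of variables makes the former \<open>t\<^sup>d \<integral>\<^sub>S f (t x) dx\<close>, and the integrand below is its
  derivative at \<open>t = 1\<close>, which is therefore nonpositive. Equivalently, the field \<open>x \<mapsto> f(x) x\<close> has the divergence \<open>d f + f' x\<close>,
  and its flux out of a set star-shaped about the origin is nonpositive.\<close>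

lemma integral_dilation_generator_nonpos:
  fixes S :: "'a::euclidean_space set" and f :: "'a \<Rightarrow> real"
  assumes S: "S \<in> sets borel" "bounded S"
    and star: "\<And>x t. x \<in> S \<Longrightarrow> 0 < t \<Longrightarrow> t < 1 \<Longrightarrow> t *\<^sub>R x \<in> S"
    and der: "\<And>x. (f has_derivative f' x) (at x)"
    and cont: "continuous_on UNIV (\<lambda>x. f' x x)"
    and nonpos: "\<And>x. x \<in> S \<Longrightarrow> f x \<le> 0"
  shows "(\<integral>x. indicator S x * (real DIM('a) * f x + f' x x) \<partial>lborel) \<le> 0"
proof -
  define d where "d = DIM('a)"
  have d: "0 < d" by (simp add: d_def)
  obtain R where R: "0 < R" "\<And>x. x \<in> S \<Longrightarrow> norm x \<le> R"
    using S(2) unfolding bounded_pos by auto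
  define B where "B = cball (0::'a) R"
  have SB: "S \<subseteq> B" using R by (auto simp: B_def)
  have contf: "continuous_on UNIV f"
    by (meson der continuous_at_imp_continuous_on has_derivative_continuous)
  have [measurable]: "f \<in> borel_measurable borel" "(\<lambda>x. f' x x) \<in> borel_measurable borel"
    "S \<in> sets borel"
    using contf cont S(1) by (simp_all add: borel_measurable_continuous_onI)
  define K where "K x = real d * f x + f' x x" for x
  have contK: "continuous_on UNIV K"
    unfolding K_def using contf cont by (intro continuous_intros)
  have "bounded (K ` B)"
    by (rule compact_imp_bounded, rule compact_continuous_image)
       (auto simp: B_def intro: continuous_on_subset[OF contK])
  then obtain C where C: "0 < C" "\<And>x. x \<in> B \<Longrightarrow> \<bar>K x\<bar> \<le> C"
    unfolding bounded_pos by (force simp: B_def)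
  have intS: "integrable lborel (\<lambda>x. indicator S x * g x)" if "continuous_on UNIV g" for g :: "'a \<Rightarrow> real"
    by (rule integrable_bounded_set[OF S that])
  have scale: "(\<integral>x. indicator S x * f x \<partial>lborel) \<le> t ^ d * (\<integral>x. indicator S x * f (t *\<^sub>R x) \<partial>lborel)"
    if t: "0 < t" "t < 1" for t
  proof -
    \<comment> \<open>The restriction of \<open>f\<close> to the dilated set \<open>t S\<close>.\<close>
    define g where "g x = indicator S ((1/t) *\<^sub>R x) * f x" for x
    have gm [measurable]: "g \<in> borel_measurable borel" unfolding g_def by measurable
    have gx: "g (t *\<^sub>R x) = indicator S x * f (t *\<^sub>R x)" for x
      using t by (simp add: g_def)
    have cs: "continuous_on UNIV (\<lambda>x. f (t *\<^sub>R x))"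
      by (rule continuous_on_compose2[OF contf]) (auto intro!: continuous_intros)
    have aff: "(lborel :: 'a measure) = density (distr lborel borel (\<lambda>x. t *\<^sub>R x)) (\<lambda>_. ennreal (t ^ d))"
      using lborel_affine[of t "0::'a"] t by (simp add: d_def)
    have gint: "integrable lborel g"
      by (subst aff, subst integrable_density)
         (use t in \<open>auto simp: integrable_distr_eq gx intro!: integrable_mult_right intS cs\<close>)
    have "integral\<^sup>L lborel g = t ^ d * (\<integral>x. indicator S x * f (t *\<^sub>R x) \<partial>lborel)"
      by (subst aff, subst integral_density)
         (use t in \<open>auto simp: integral_distr gx\<close>)
    moreover have "(\<integral>x. indicator S x * f x \<partial>lborel) \<le> integral\<^sup>L lborel g"
    proof (rule integral_mono[OF intS[OF contf] gint])
      fix x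
      show "indicator S x * f x \<le> g x"
      proof (cases "(1/t) *\<^sub>R x \<in> S")
        case True
        then have "x \<in> S" using star[of "(1/t) *\<^sub>R x" t] t by simp
        with True show ?thesis by (simp add: g_def)
      next
        case False
        then show ?thesis using nonpos by (auto simp: g_def indicator_def)
      qed
    qed
    ultimately show ?thesis by simp
  qed
  define t :: "nat \<Rightarrow> real" where "t n = 1 - 1 / real (n + 2)" for n
  have t: "0 < t n" "t n < 1" for n by (auto simp: t_def)
  have t1: "t \<longlonglongrightarrow> 1"
  proof -
    have "(\<lambda>n. 1 / real (n + 2)) \<longlonglongrightarrow> 0"
      using LIMSEQ_ignore_initial_segment[OF lim_1_over_n, of 2] by simp
    from tendsto_diff[OF tendsto_const this, of 1] show ?thesis by (simp add: t_def [abs_def])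
  qed
  have dline: "((\<lambda>t. t ^ d * f (t *\<^sub>R x)) has_real_derivative t ^ (d - 1) * K (t *\<^sub>R x)) (at t)"
    for x t
  proof -
    have 1: "((\<lambda>t. f (0 + t *\<^sub>R x)) has_real_derivative f' (0 + t *\<^sub>R x) x) (at t)"
      by (rule DERIV_along_line[OF der])
    have lin: "linear (f' (t *\<^sub>R x))"
      using der has_derivative_bounded_linear bounded_linear.linear by blast
    have "((\<lambda>t. t ^ d * f (t *\<^sub>R x)) has_real_derivative
        (real d * t ^ (d - 1)) * f (t *\<^sub>R x) + f' (t *\<^sub>R x) x * t ^ d) (at t)"
      using 1 by (auto intro!: derivative_eq_intros)
    moreover have "t ^ d = t ^ (d - 1) * t" using d by (cases d) auto
    ultimately show ?thesis
      by (simp add: K_def linear_cmul[OF lin] algebra_simps)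
  qed
  \<comment> \<open>Difference quotients in the dilation parameter, with \<open>t n\<close> tending to \<open>1\<close> from below.\<close>
  define q where "q n x = indicator S x * ((t n ^ d * f (t n *\<^sub>R x) - f x) / (t n - 1))" for n x
  have cs: "continuous_on UNIV (\<lambda>x. f (c *\<^sub>R x))" for c
    by (rule continuous_on_compose2[OF contf]) (auto intro!: continuous_intros)
  have q_int: "integrable lborel (q n)" "integral\<^sup>L lborel (q n) \<le> 0" for n
  proof -
    have eq: "q n x = (t n ^ d * (indicator S x * f (t n *\<^sub>R x)) - indicator S x * f x) / (t n - 1)" for x
      by (simp add: q_def algebra_simps)
    show "integrable lborel (q n)"
      unfolding eq [abs_def] by (intro integrable_divide Bochner_Integration.integrable_diff integrable_mult_right intS cs contf)
    have "integral\<^sup>L lborel (q n) = (t n ^ d * (\<integral>x. indicator S x * f (t n *\<^sub>R x) \<partial>lborel)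
        - (\<integral>x. indicator S x * f x \<partial>lborel)) / (t n - 1)"
      unfolding eq [abs_def] by (simp add: intS cs contf)
    then show "integral\<^sup>L lborel (q n) \<le> 0"
      using scale[OF t] t(2)[of n] by (simp add: divide_nonneg_neg)
  qed
  have "(\<lambda>n. integral\<^sup>L lborel (q n)) \<longlonglongrightarrow> (\<integral>x. indicator S x * K x \<partial>lborel)"
  proof (rule integral_dominated_convergence[where w = "\<lambda>x. indicator S x * C"])
    show "(\<lambda>x. indicator S x * K x) \<in> borel_measurable lborel"
      unfolding K_def by measurable
    show "q n \<in> borel_measurable lborel" for n
      using q_int(1) by (rule borel_measurable_integrable)
    show "integrable lborel (\<lambda>x. indicator S x * C)"
      by (intro intS continuous_intros)
    show "AE x in lborel. (\<lambda>n. q n x) \<longlonglongrightarrow> indicator S x * K x"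
    proof (rule AE_I2)
      fix x
      have "((\<lambda>z. (z ^ d * f (z *\<^sub>R x) - f x) / (z - 1)) \<longlongrightarrow> K x) (at 1)"
        using dline[of x 1] by (simp add: has_field_derivative_iff)
      moreover have "filterlim t (at 1) sequentially"
        using t1 t(2) by (auto simp: filterlim_at less_imp_neq)
      ultimately have "(\<lambda>n. (t n ^ d * f (t n *\<^sub>R x) - f x) / (t n - 1)) \<longlonglongrightarrow> K x"
        by (rule filterlim_compose)
      then show "(\<lambda>n. q n x) \<longlonglongrightarrow> indicator S x * K x"
        unfolding q_def by (intro tendsto_intros)
    qed
    show "AE x in lborel. norm (q n x) \<le> indicator S x * C" for n
    proof (rule AE_I2)
      fix x
      show "norm (q n x) \<le> indicator S x * C"
      proof (cases "x \<in> S")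
        case True
        obtain z where z: "t n < z" "z < 1"
          "1 ^ d * f (1 *\<^sub>R x) - t n ^ d * f (t n *\<^sub>R x) = (1 - t n) * (z ^ (d - 1) * K (z *\<^sub>R x))"
          using MVT2[of "t n" 1 "\<lambda>t. t ^ d * f (t *\<^sub>R x)" "\<lambda>t. t ^ (d - 1) * K (t *\<^sub>R x)"]
            t(2) dline[of x] by blast
        have z0: "0 < z" using z t(1)[of n] by linarith
        then have "z *\<^sub>R x \<in> B" using star[of x z] True z SB by auto
        then have K: "\<bar>K (z *\<^sub>R x)\<bar> \<le> C" by (rule C)
        have "(t n ^ d * f (t n *\<^sub>R x) - f x) / (t n - 1) = z ^ (d - 1) * K (z *\<^sub>R x)"
          using z(3) t(2)[of n] by (simp add: field_simps)
        moreover have "\<bar>z ^ (d - 1) * K (z *\<^sub>R x)\<bar> \<le> 1 * C"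
          unfolding abs_mult
          by (rule mult_mono) (use z0 z K power_le_one[of z "d - 1"] in auto)
        ultimately show ?thesis using True by (simp add: q_def)
      qed (simp add: q_def)
    qed
  qed
  then have "(\<integral>x. indicator S x * K x \<partial>lborel) \<le> 0"
    by (rule LIMSEQ_le_const2) (use q_int in auto)
  then show ?thesis by (simp add: K_def d_def)
qed

section \<open>The Bessel function of order zero in the squared variable\<close>

text \<open>The entire function \<open>B\<close> with \<open>J0(x) = B(x\<^sup>2/4)\<close>. Working with \<open>B\<close> makes \<open>J0(j |x|)\<close> visibly smooth
  at the origin and gives the differential equation polynomial coefficients.\<close>

definition bessel_sq :: "real \<Rightarrow> real" where
  "bessel_sq s = (\<Sum>n. (-1) ^ n / (fact n)\<^sup>2 * s ^ n)"

definition dbessel_sq :: "real \<Rightarrow> real" where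
  "dbessel_sq s = (\<Sum>n. diffs (\<lambda>n. (-1) ^ n / (fact n)\<^sup>2) n * s ^ n)"

definition ddbessel_sq :: "real \<Rightarrow> real" where
  "ddbessel_sq s = (\<Sum>n. diffs (diffs (\<lambda>n. (-1) ^ n / (fact n)\<^sup>2)) n * s ^ n)"

lemma bessel_J0_eq_bessel_sq: "bessel_J0 x = bessel_sq (x\<^sup>2 / 4)"
  by (simp add: bessel_J0_def bessel_sq_def power_mult power_divide)

lemma summable_bessel_sq: "summable (\<lambda>n. (-1) ^ n / (fact n)\<^sup>2 * (s::real) ^ n)"
proof (rule summable_comparison_test')
  show "summable (\<lambda>n. inverse (fact n) * \<bar>s\<bar> ^ n)"
    by (rule summable_exp)
  show "norm ((-1) ^ n / (fact n)\<^sup>2 * s ^ n) \<le> inverse (fact n) * \<bar>s\<bar> ^ n" for n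
  proof -
    have "1 / (fact n)\<^sup>2 \<le> inverse (fact n :: real)"
      using fact_ge_1[of n, where ?'a=real] by (simp add: field_simps power2_eq_square)
    then show ?thesis
      by (simp add: abs_mult power_abs divide_inverse mult_right_mono)
  qed
qed

lemma DERIV_bessel_sq: "(bessel_sq has_real_derivative dbessel_sq s) (at s)"
proof -
  have "(bessel_sq has_field_derivative (\<Sum>n. diffs (\<lambda>n. (-1) ^ n / (fact n)\<^sup>2) n * s ^ n)) (at s)"
    unfolding bessel_sq_def [abs_def]
    by (rule termdiffs_strong[OF summable_bessel_sq[of "\<bar>s\<bar> + 1"]]) simp
  then show ?thesis by (simp add: dbessel_sq_def)
qed

lemma DERIV_dbessel_sq: "(dbessel_sq has_real_derivative ddbessel_sq s) (at s)"
proof -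
  have "(dbessel_sq has_field_derivative
      (\<Sum>n. diffs (diffs (\<lambda>n. (-1) ^ n / (fact n)\<^sup>2)) n * s ^ n)) (at s)"
    unfolding dbessel_sq_def [abs_def]
    by (rule termdiffs_strong[of _ "\<bar>s\<bar> + 1"])
       (auto intro!: termdiff_converges_all summable_bessel_sq)
  then show ?thesis by (simp add: ddbessel_sq_def)
qed

text \<open>Bessel's equation in the variable \<open>s = x\<^sup>2/4\<close>; equivalently \<open>(s B')' = - B\<close>, the form used for all
  the monotonicity arguments below. On coefficients it says \<open>(n + 1)\<^sup>2 c\<^sub>n\<^sub>+\<^sub>1 = - c\<^sub>n\<close>.\<close>

lemma bessel_sq_ode: "s * ddbessel_sq s + dbessel_sq s + bessel_sq s = 0"
proof -
  define c :: "nat \<Rightarrow> real" where "c = (\<lambda>n. (-1) ^ n / (fact n)\<^sup>2)"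
  have s0: "summable (\<lambda>n. c n * x ^ n)" for x
    unfolding c_def by (rule summable_bessel_sq)
  have s1: "summable (\<lambda>n. diffs c n * x ^ n)" for x
    by (rule termdiff_converges_all) (rule s0)
  have s2: "summable (\<lambda>n. diffs (diffs c) n * x ^ n)" for x
    by (rule termdiff_converges_all) (rule s1)
  have c: "real (Suc n) * real (Suc n) * c (Suc n) + c n = 0" for n
    by (simp add: c_def power2_eq_square divide_simps del: of_nat_Suc) 
  have "(\<lambda>n. diffs (diffs c) n * s ^ n) sums ddbessel_sq s"
    using s2[of s] by (simp add: ddbessel_sq_def c_def summable_sums)
  then have "(\<lambda>n. s * (diffs (diffs c) n * s ^ n)) sums (s * ddbessel_sq s)"
    by (rule sums_mult)
  then have "(\<lambda>n. real (Suc n) * diffs c (Suc n) * s ^ Suc n) sums (s * ddbessel_sq s)"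
    by (simp add: diffs_def[of "diffs c"] algebra_simps)
  then have a: "(\<lambda>n. real n * diffs c n * s ^ n) sums (s * ddbessel_sq s)"
    using sums_Suc_iff[of "\<lambda>n. real n * diffs c n * s ^ n" "s * ddbessel_sq s"] by simp
  have b: "(\<lambda>n. diffs c n * s ^ n) sums dbessel_sq s"
    using s1[of s] by (simp add: dbessel_sq_def c_def summable_sums)
  have d: "(\<lambda>n. c n * s ^ n) sums bessel_sq s"
    using s0[of s] by (simp add: bessel_sq_def c_def summable_sums)
  have "(\<lambda>n. real n * diffs c n * s ^ n + diffs c n * s ^ n + c n * s ^ n) sums
      (s * ddbessel_sq s + dbessel_sq s + bessel_sq s)"
    by (intro sums_add a b d)
  moreover have "real n * diffs c n * s ^ n + diffs c n * s ^ n + c n * s ^ n = 0" for n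
  proof -
    have "real n * diffs c n * s ^ n + diffs c n * s ^ n + c n * s ^ n
        = (real (Suc n) * real (Suc n) * c (Suc n) + c n) * s ^ n"
      by (simp add: diffs_def algebra_simps)
    then show ?thesis using c by simp
  qed
  ultimately show ?thesis
    by (simp add: sums_unique2[OF _ sums_zero])
qed

lemma bessel_sq_0: "bessel_sq 0 = 1"
  using powser_zero[of "\<lambda>n. (-1) ^ n / (fact n)\<^sup>2 :: real"] by (simp add: bessel_sq_def)

lemma continuous_bessel_sq: "continuous_on A bessel_sq"
  by (meson DERIV_bessel_sq DERIV_isCont continuous_at_imp_continuous_on)

lemma continuous_dbessel_sq: "continuous_on A dbessel_sq"
  by (meson DERIV_dbessel_sq DERIV_isCont continuous_at_imp_continuous_on)

text \<open>From the power \<open>s\<^sup>4\<close> on the series alternates with decreasing terms, so its value is at most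
  the sum of its first five terms, which is about \<open>-0.022\<close>. The resulting bound \<open>3/2\<close> on the
  first zero, which is about \<open>1.4458\<close>, yields \<open>J0(j r) \<ge> 1 - (3/2) r\<^sup>2\<close> in \<open>weighted_moment_nonneg\<close>.\<close>

lemma bessel_sq_three_halves: "bessel_sq (3/2) < 0"
proof -
  define c :: "nat \<Rightarrow> real" where "c = (\<lambda>n. (-1) ^ n / (fact n)\<^sup>2 * (3/2) ^ n)"
  define a :: "nat \<Rightarrow> real" where "a = (\<lambda>n. (3/2) ^ (n + 4) / (fact (n + 4))\<^sup>2)"
  have sc: "summable c" unfolding c_def by (rule summable_bessel_sq)
  have ca: "c (n + 4) = (-1) ^ n * a n" for n
    by (simp add: c_def a_def power_add)
  have a_pos: "0 \<le> a n" for n by (simp add: a_def)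
  have "a (Suc n) \<le> a n" for n
  proof -
    have "a (Suc n) = a n * ((3/2) / (real (n + 5))\<^sup>2)"
    proof -
      have f: "fact (Suc n + 4) = real (n + 5) * (fact (n + 4) :: real)"
        using fact_Suc[of "n + 4", where ?'a = real] by (simp add: eval_nat_numeral)
      have p: "(3/2 :: real) ^ (Suc n + 4) = (3/2) ^ (n + 4) * (3/2)"
        by (metis add_Suc power_Suc2)
      show ?thesis
        unfolding a_def f p power_mult_distrib by (simp add: mult.commute)
    qed
    also have "\<dots> \<le> a n * 1"
    proof (rule mult_left_mono[OF _ a_pos])
      have "(5::real)\<^sup>2 \<le> (real (n + 5))\<^sup>2" by (rule power_mono) auto
      then show "(3/2) / (real (n + 5))\<^sup>2 \<le> 1" by simp
    qed
    finally show ?thesis by simp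
  qed
  moreover have "a \<longlonglongrightarrow> 0"
  proof -
    have "(\<lambda>n. c (n + 4)) \<longlonglongrightarrow> 0"
      using summable_LIMSEQ_zero[OF sc] LIMSEQ_ignore_initial_segment by blast
    then have "(\<lambda>n. norm (c (n + 4))) \<longlonglongrightarrow> 0" by (rule tendsto_norm_zero)
    then show ?thesis using a_pos by (simp add: ca abs_mult)
  qed
  ultimately have "(\<Sum>n. (-1) ^ n * a n) \<le> (\<Sum>i<2 * 0 + 1. (-1) ^ i * a i)"
    by (intro summable_Leibniz'(4)) (use a_pos in auto)
  then have "(\<Sum>n. c (n + 4)) \<le> a 0" by (simp add: ca)
  moreover have "bessel_sq (3/2) = (\<Sum>n. c (n + 4)) + (\<Sum>i<4. c i)"
    using suminf_split_initial_segment[OF sc, of 4] by (simp add: bessel_sq_def c_def)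
  moreover have "a 0 + (\<Sum>i<4. c i) < 0"
    by (simp add: a_def c_def eval_nat_numeral fact_Suc)
  ultimately show ?thesis by linarith
qed

lemma bessel_sq_first_zero_exists:
  obtains m where "0 < m" "m \<le> 3/2" "bessel_sq m = 0" "\<And>s. 0 \<le> s \<Longrightarrow> s < m \<Longrightarrow> 0 < bessel_sq s"
proof -
  define Z where "Z = {s \<in> {0..3/2}. bessel_sq s = 0}"
  note cont = continuous_bessel_sq
  have "\<exists>s. 0 \<le> s \<and> s \<le> 3/2 \<and> bessel_sq s = 0"
    using IVT2'[of bessel_sq "3/2" 0 0] bessel_sq_three_halves bessel_sq_0 cont by auto
  then have ne: "Z \<noteq> {}" by (auto simp: Z_def)
  have "closed Z" unfolding Z_def
    using continuous_closed_preimage_constant[of "{0..3/2}" bessel_sq 0] cont by simp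
  then have "compact Z"
    using bounded_subset[OF bounded_closed_interval, of Z 0 "3/2"]
    by (metis (lifting) Z_def compact_eq_bounded_closed mem_Collect_eq subsetI)
  then obtain m where m: "m \<in> Z" "\<And>s. s \<in> Z \<Longrightarrow> m \<le> s"
    using compact_attains_inf[of Z] ne by blast
  have "m \<noteq> 0" using m(1) bessel_sq_0 by (auto simp: Z_def)
  moreover have "0 < bessel_sq s" if s: "0 \<le> s" "s < m" for s
  proof (rule ccontr)
    assume "\<not> 0 < bessel_sq s"
    then obtain x where "0 \<le> x" "x \<le> s" "bessel_sq x = 0"
      using IVT2'[of bessel_sq s 0 0] bessel_sq_0 cont[of "{0..s}"] s by auto
    then have "x \<in> Z" using s m(1) by (auto simp: Z_def)
    then show False using m(2)[of x] \<open>x \<le> s\<close> s by simp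
  qed
  moreover have "0 \<le> m" "m \<le> 3/2" "bessel_sq m = 0" using m(1) by (auto simp: Z_def)
  ultimately show ?thesis by (intro that[of m]) auto
qed

text \<open>The constant \<open>j\<^sup>2/4\<close>, named after what the next lemma proves about it. The eigenvalue of the
  one-dimensional problem on the unit interval is \<open>j\<^sup>2\<close>, that is \<open>4 * first_zero\<close>.\<close>

definition first_zero :: real where "first_zero = j01\<^sup>2 / 4"

lemma first_zero: "0 < first_zero" "first_zero \<le> 3/2" "bessel_sq first_zero = 0" "\<And>s. 0 \<le> s \<Longrightarrow> s < first_zero \<Longrightarrow> 0 < bessel_sq s"
proof -
  obtain m where m: "0 < m" "m \<le> 3/2" "bessel_sq m = 0" "\<And>s. 0 \<le> s \<Longrightarrow> s < m \<Longrightarrow> 0 < bessel_sq s"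
    by (rule bessel_sq_first_zero_exists) blast
  have "j01 = 2 * sqrt m"
    unfolding j01_def
  proof (rule Least_equality)
    show "0 < 2 * sqrt m \<and> bessel_J0 (2 * sqrt m) = 0"
      using m by (simp add: bessel_J0_eq_bessel_sq power_mult_distrib)
    fix y assume y: "0 < y \<and> bessel_J0 y = 0"
    have "m \<le> y\<^sup>2 / 4"
      using m(4)[of "y\<^sup>2 / 4"] y by (force simp: bessel_J0_eq_bessel_sq)
    then have "sqrt m \<le> sqrt (y\<^sup>2 / 4)" by simp
    then show "2 * sqrt m \<le> y" using y by (simp add: real_sqrt_divide)
  qed
  then have "first_zero = (2 * sqrt m)\<^sup>2 / 4" by (simp only: first_zero_def)
  then have "first_zero = m" using m(1) by (simp add: power_mult_distrib)
  with m show "0 < first_zero" "first_zero \<le> 3/2" "bessel_sq first_zero = 0" "\<And>s. 0 \<le> s \<Longrightarrow> s < first_zero \<Longrightarrow> 0 < bessel_sq s"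
    by auto
qed

lemma bessel_sq_nonneg: "0 \<le> s \<Longrightarrow> s \<le> first_zero \<Longrightarrow> 0 \<le> bessel_sq s"
  using first_zero(3) first_zero(4)[of s] by (cases "s = first_zero") auto

text \<open>The derivative of \<open>s B'\<close> is \<open>- B\<close>, which is nonpositive up to the first zero.\<close>

lemma dbessel_sq_nonpos:
  assumes "0 < s" "s \<le> first_zero" shows "dbessel_sq s \<le> 0"
proof -
  have "s * dbessel_sq s \<le> 0 * dbessel_sq 0"
  proof (rule DERIV_nonpos_imp_nonincreasing[of 0 s "\<lambda>s. s * dbessel_sq s"])
    fix x assume x: "0 \<le> x" "x \<le> s"
    have "((\<lambda>s. s * dbessel_sq s) has_real_derivative (x * ddbessel_sq x + dbessel_sq x)) (at x)"
      by (auto intro!: derivative_eq_intros DERIV_dbessel_sq)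
    moreover have "x * ddbessel_sq x + dbessel_sq x \<le> 0"
      using bessel_sq_ode[of x] bessel_sq_nonneg[of x] x assms by linarith
    ultimately show "\<exists>y. ((\<lambda>s. s * dbessel_sq s) has_real_derivative y) (at x) \<and> y \<le> 0" by blast
  qed (use assms in auto)
  then show ?thesis using assms(1) by (simp add: mult_le_0_iff)
qed

lemma bessel_sq_le_1:
  assumes "0 \<le> s" "s \<le> first_zero" shows "bessel_sq s \<le> 1"
proof -
  have "bessel_sq s \<le> bessel_sq 0"
  proof (rule DERIV_nonpos_imp_decreasing_open[of 0 s bessel_sq])
    show "\<exists>y. (bessel_sq has_real_derivative y) (at x) \<and> y \<le> 0" if "0 < x" "x < s" for x
      using that assms DERIV_bessel_sq[of x] dbessel_sq_nonpos[of x] by force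
    show "continuous_on {0..s} bessel_sq" by (rule continuous_bessel_sq)
  qed (use assms in auto)
  then show ?thesis by (simp add: bessel_sq_0)
qed

text \<open>The derivative of \<open>s (B + B')\<close> is \<open>s B'\<close>, which is nonpositive. In terms of \<open>f(r) = J0(j r)\<close> this is
  \<open>- f' \<ge> (j\<^sup>2/2) r f\<close>.\<close>

lemma bessel_sq_plus_dbessel_sq_nonpos:
  assumes "0 < s" "s \<le> first_zero" shows "bessel_sq s + dbessel_sq s \<le> 0"
proof -
  have "s * (bessel_sq s + dbessel_sq s) \<le> 0 * (bessel_sq 0 + dbessel_sq 0)"
  proof (rule DERIV_nonpos_imp_nonincreasing[of 0 s "\<lambda>s. s * (bessel_sq s + dbessel_sq s)"])
    fix x assume x: "0 \<le> x" "x \<le> s"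
    have "((\<lambda>s. s * (bessel_sq s + dbessel_sq s)) has_real_derivative
        (x * (dbessel_sq x + ddbessel_sq x) + (bessel_sq x + dbessel_sq x))) (at x)"
      by (auto intro!: derivative_eq_intros DERIV_dbessel_sq DERIV_bessel_sq)
    moreover have "x * (dbessel_sq x + ddbessel_sq x) + (bessel_sq x + dbessel_sq x) = x * dbessel_sq x"
      using bessel_sq_ode[of x] by (simp add: algebra_simps)
    moreover have "x * dbessel_sq x \<le> 0"
      using dbessel_sq_nonpos[of x] x assms by (cases "x = 0") (auto simp: mult_le_0_iff)
    ultimately show "\<exists>y. ((\<lambda>s. s * (bessel_sq s + dbessel_sq s)) has_real_derivative y) (at x) \<and> y \<le> 0"
      by auto
  qed (use assms in auto)
  then show ?thesis using assms(1) by (simp add: mult_le_0_iff)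
qed

text \<open>The derivative of \<open>s (B' + 1)\<close> is \<open>1 - B\<close>, which is nonnegative.\<close>

lemma dbessel_sq_ge_minus_1:
  assumes "0 < s" "s \<le> first_zero" shows "- 1 \<le> dbessel_sq s"
proof -
  have "0 * (dbessel_sq 0 + 1) \<le> s * (dbessel_sq s + 1)"
  proof (rule DERIV_nonneg_imp_nondecreasing[of 0 s "\<lambda>s. s * (dbessel_sq s + 1)"])
    fix x assume x: "0 \<le> x" "x \<le> s"
    have "((\<lambda>s. s * (dbessel_sq s + 1)) has_real_derivative (x * ddbessel_sq x + (dbessel_sq x + 1))) (at x)"
      by (auto intro!: derivative_eq_intros DERIV_dbessel_sq)
    moreover have "0 \<le> x * ddbessel_sq x + (dbessel_sq x + 1)"
      using bessel_sq_ode[of x] bessel_sq_le_1[of x] x assms by linarith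
    ultimately show "\<exists>y. ((\<lambda>s. s * (dbessel_sq s + 1)) has_real_derivative y) (at x) \<and> 0 \<le> y"
      by blast
  qed (use assms in auto)
  then show ?thesis using assms(1) by (simp add: zero_le_mult_iff)
qed

lemma bessel_sq_ge:
  assumes "0 \<le> s" "s \<le> first_zero" shows "1 - s \<le> bessel_sq s"
proof -
  have "bessel_sq 0 + 0 \<le> bessel_sq s + s"
  proof (rule DERIV_nonneg_imp_increasing_open[of 0 s "\<lambda>s. bessel_sq s + s"])
    show "\<exists>y. ((\<lambda>s. bessel_sq s + s) has_real_derivative y) (at x) \<and> 0 \<le> y" if "0 < x" "x < s" for x
    proof (intro exI conjI)
      show "((\<lambda>s. bessel_sq s + s) has_real_derivative dbessel_sq x + 1) (at x)"
        by (auto intro!: derivative_eq_intros DERIV_bessel_sq)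
      show "0 \<le> dbessel_sq x + 1" using dbessel_sq_ge_minus_1[of x] that assms by simp
    qed
    show "continuous_on {0..s} (\<lambda>s. bessel_sq s + s)"
      by (intro continuous_on_add continuous_on_id continuous_bessel_sq)
  qed (use assms in auto)
  then show ?thesis by (simp add: bessel_sq_0)
qed

lemma first_zero_ge_1: "1 \<le> first_zero"
  using bessel_sq_ge[of first_zero] first_zero(1,3) by simp

section \<open>The one-dimensional profile\<close>

text \<open>The odd function \<open>sgn s * J0(j (1 - |s|))\<close> and its derivative. The two branches fit together at \<open>0\<close> because
  \<open>J0(j) = 0\<close>, and oddness makes the one-sided derivatives agree there.\<close>

definition profile :: "real \<Rightarrow> real" where
  "profile s = sgn s * bessel_sq (first_zero * (1 - \<bar>s\<bar>)\<^sup>2)"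

definition dprofile :: "real \<Rightarrow> real" where
  "dprofile s = - 2 * first_zero * (1 - \<bar>s\<bar>) * dbessel_sq (first_zero * (1 - \<bar>s\<bar>)\<^sup>2)"

lemma DERIV_profile: "(profile has_real_derivative dprofile s) (at s)"
proof -
  define f where "f x = bessel_sq (first_zero * (1 - x)\<^sup>2)" for x
  define f' where "f' x = - 2 * first_zero * (1 - x) * dbessel_sq (first_zero * (1 - x)\<^sup>2)" for x
  have f: "(f has_real_derivative f' x) (at x within A)" for x A
  proof -
    have "((\<lambda>x. bessel_sq (first_zero * (1 - x)\<^sup>2)) has_real_derivative
        dbessel_sq (first_zero * (1 - x)\<^sup>2) * (first_zero * (2 * (1 - x) * (- 1)))) (at x within A)"
      by (rule DERIV_chain2[OF DERIV_bessel_sq]) (auto intro!: derivative_eq_intros)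
    then show ?thesis by (simp add: f_def [abs_def] f'_def algebra_simps)
  qed
  have g: "((\<lambda>x. - f (- x)) has_real_derivative f' (- x)) (at x within A)" for x A
  proof -
    have "((\<lambda>x. f (- x)) has_real_derivative f' (- x) * (- 1)) (at x within A)"
      by (rule DERIV_chain2[OF f]) (auto intro!: derivative_eq_intros)
    from DERIV_minus[OF this] show ?thesis by simp
  qed
  have f0: "f 0 = 0" using first_zero(3) by (simp add: f_def)
  have pos: "profile x = f x" if "0 \<le> x" for x
    using that f0 by (cases "x = 0") (auto simp: profile_def f_def)
  have neg: "profile x = - f (- x)" if "x \<le> 0" for x
    using that f0 by (cases "x = 0") (auto simp: profile_def f_def)
  consider "0 < s" | "s < 0" | "s = 0" by linarith
  then show ?thesis
  proof cases
    case 1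
    have "(profile has_real_derivative f' s) (at s)"
      by (rule has_field_derivative_transform_within_open[where S = "{0<..}", OF f]) (use 1 pos in auto)
    then show ?thesis using 1 by (simp add: f'_def dprofile_def)
  next
    case 2
    have "(profile has_real_derivative f' (- s)) (at s)"
      by (rule has_field_derivative_transform_within_open[where S = "{..<0}", OF g]) (use 2 neg in auto)
    then show ?thesis using 2 by (simp add: f'_def dprofile_def)
  next
    case 3
    have r: "(profile has_real_derivative f' 0) (at 0 within {0..})"
      by (rule has_field_derivative_transform_within[OF f, of 1]) (auto simp: pos)
    have l: "(profile has_real_derivative f' 0) (at 0 within {..0})"
      using has_field_derivative_transform_within[OF g, of 1 0 "{..0}" profile] by (auto simp: neg)
    have "(profile has_real_derivative f' 0) (at 0 within {0..} \<union> {..0})"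
      using r l by (simp add: has_field_derivative_iff Lim_within_Un)
    moreover have "{0..} \<union> {..0} = (UNIV :: real set)" by auto
    ultimately show ?thesis using 3 by (simp add: f'_def dprofile_def)
  qed
qed

lemma continuous_dprofile: "continuous_on UNIV dprofile"
  unfolding dprofile_def
  by (intro continuous_intros continuous_on_compose2[OF continuous_dbessel_sq[of UNIV]]) auto

lemma continuous_profile: "continuous_on UNIV profile"
  by (meson DERIV_profile DERIV_isCont continuous_at_imp_continuous_on)

section \<open>Integration along the rays from a vertex\<close>

text \<open>The set \<open>S\<close> is a half domain translated so that the vertex is the origin; \<open>a = - r\<close> is the negative
  distance from the vertex along the axis. The integrand on the left is \<open>|\<nabla>u|\<^sup>2 - j\<^sup>2 u\<^sup>2\<close>.

  The dilation inequality is applied to a multiple of \<open>G = q f f' / r\<close>, which is smooth because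
  \<open>f' / r\<close> is. Differentiating along the dilations, Bessel's equation eliminates the second derivative of \<open>f\<close>
  and yields the integrand up to terms containing \<open>t\<^sup>2\<close>. Those are estimated pointwise by
  \<open>B \<le> - B'\<close>, \<open>first_zero \<ge> 1\<close> and \<open>|t| \<le> 1\<close>. With a general trial factor \<open>1 - c t\<^sup>2\<close> the constant
  on the right would be \<open>4 c (2 - 3 c)\<close>, which is largest for \<open>c = 1/3\<close>.\<close>

lemma radial_estimate:
  fixes S :: "(real \<times> real) set"
  assumes S: "S \<in> sets borel" "bounded S"
    and star: "\<And>x t. x \<in> S \<Longrightarrow> 0 < t \<Longrightarrow> t < 1 \<Longrightarrow> t *\<^sub>R x \<in> S"
    and strip: "\<And>a t. (a, t) \<in> S \<Longrightarrow> - 1 < a \<and> a < 0 \<and> \<bar>t\<bar> \<le> 1"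
  shows "(\<integral>z. indicator S z * (4 * first_zero\<^sup>2 * (fst z)\<^sup>2 * (dbessel_sq (first_zero * (fst z)\<^sup>2))\<^sup>2 * (1 - (snd z)\<^sup>2/3)\<^sup>2
            + 4/9 * (snd z)\<^sup>2 * (bessel_sq (first_zero * (fst z)\<^sup>2))\<^sup>2
            - 4 * first_zero * (bessel_sq (first_zero * (fst z)\<^sup>2))\<^sup>2 * (1 - (snd z)\<^sup>2/3)\<^sup>2) \<partial>lborel)
      \<le> - (4/3) * (\<integral>z. indicator S z * ((snd z)\<^sup>2 * (bessel_sq (first_zero * (fst z)\<^sup>2))\<^sup>2) \<partial>lborel)"
    (is "?L \<le> - (4/3) * ?R")
proof -
  define b where "b a = bessel_sq (first_zero * a\<^sup>2)" for a
  define d where "d a = dbessel_sq (first_zero * a\<^sup>2)" for a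
  define e where "e a = ddbessel_sq (first_zero * a\<^sup>2)" for a
  have b': "(b has_real_derivative 2 * first_zero * a * d a) (at a)" for a
  proof -
    have "((\<lambda>x. bessel_sq (first_zero * x\<^sup>2)) has_real_derivative dbessel_sq (first_zero * a\<^sup>2) * (first_zero * (2 * a))) (at a)"
      by (rule DERIV_chain2[OF DERIV_bessel_sq]) (auto intro!: derivative_eq_intros)
    then show ?thesis by (simp add: b_def [abs_def] d_def algebra_simps)
  qed
  have d': "(d has_real_derivative 2 * first_zero * a * e a) (at a)" for a
  proof -
    have "((\<lambda>x. dbessel_sq (first_zero * x\<^sup>2)) has_real_derivative ddbessel_sq (first_zero * a\<^sup>2) * (first_zero * (2 * a))) (at a)"
      by (rule DERIV_chain2[OF DERIV_dbessel_sq]) (auto intro!: derivative_eq_intros)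
    then show ?thesis by (simp add: d_def [abs_def] e_def algebra_simps)
  qed
  have ode: "first_zero * a\<^sup>2 * e a = - d a - b a" for a
    using bessel_sq_ode[of "first_zero * a\<^sup>2"] by (simp add: b_def d_def e_def)
  have contb: "continuous_on A b" and contd: "continuous_on A d" for A
    using b' d' by (meson DERIV_isCont continuous_at_imp_continuous_on)+
  have contb2 [continuous_intros]: "continuous_on A (\<lambda>z. b (fst z))"
    and contd2 [continuous_intros]: "continuous_on A (\<lambda>z. d (fst z))" for A :: "(real \<times> real) set"
    by (auto intro!: continuous_on_compose2[OF contb[of UNIV]] continuous_on_compose2[OF contd[of UNIV]] continuous_intros)
  define G where "G z = (1 - (snd z)\<^sup>2/3)\<^sup>2 * (b (fst z) * d (fst z))" for z :: "real \<times> real"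
  define G' where "G' z h = (1 - (snd z)\<^sup>2/3)\<^sup>2 * (2 * first_zero * fst z * fst h * ((d (fst z))\<^sup>2 + b (fst z) * e (fst z)))
      - 4/3 * snd z * snd h * (1 - (snd z)\<^sup>2/3) * (b (fst z) * d (fst z))" for z h :: "real \<times> real"
  have derG: "(G has_derivative G' z) (at z)" for z
  proof -
    have bd: "((\<lambda>z. b (fst z)) has_derivative (\<lambda>h. (2 * first_zero * fst z * d (fst z)) * fst h)) (at z)"
      by (rule has_derivative_compose[of fst fst _ _ b])
         (use b' in \<open>auto simp: has_field_derivative_def intro!: derivative_eq_intros\<close>)
    have dd: "((\<lambda>z. d (fst z)) has_derivative (\<lambda>h. (2 * first_zero * fst z * e (fst z)) * fst h)) (at z)"
      by (rule has_derivative_compose[of fst fst _ _ d])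
         (use d' in \<open>auto simp: has_field_derivative_def intro!: derivative_eq_intros\<close>)
    have "((\<lambda>t. (1 - t\<^sup>2/3)\<^sup>2) has_real_derivative - 4/3 * t * (1 - t\<^sup>2/3)) (at t)" for t :: real
      by (auto intro!: derivative_eq_intros simp: power2_eq_square field_simps)
    then have qd: "((\<lambda>z. (1 - (snd z)\<^sup>2/3)\<^sup>2) has_derivative
        (\<lambda>h. (- 4/3 * snd z * (1 - (snd z)\<^sup>2/3)) * snd h)) (at z)"
      by (intro has_derivative_compose[of snd snd _ _ "\<lambda>t. (1 - t\<^sup>2/3)\<^sup>2"])
         (auto simp: has_field_derivative_def intro!: derivative_eq_intros)
    show ?thesis
      unfolding G_def [abs_def] G'_def [abs_def]
      by (rule has_derivative_eq_rhs[OF has_derivative_mult[OF qd has_derivative_mult[OF bd dd]]])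
         (simp add: fun_eq_iff power2_eq_square algebra_simps)
  qed
  \<comment> \<open>The value of \<open>2 G + G'\<close> after Bessel's equation has removed the second derivative \<open>e\<close>.\<close>
  define K where "K z = 2 * (1 - (snd z)\<^sup>2/3)\<^sup>2 * (first_zero * (fst z)\<^sup>2 * (d (fst z))\<^sup>2 - (b (fst z))\<^sup>2)
      - 4/3 * (snd z)\<^sup>2 * (1 - (snd z)\<^sup>2/3) * (b (fst z) * d (fst z))" for z :: "real \<times> real"
  have K: "2 * G z + G' z z = K z" for z
  proof -
    have "first_zero * fst z * fst z * (b (fst z) * e (fst z)) = b (fst z) * (first_zero * (fst z)\<^sup>2 * e (fst z))"
      by (simp add: power2_eq_square)
    also have "\<dots> = - b (fst z) * d (fst z) - (b (fst z))\<^sup>2"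
      unfolding ode by (simp add: power2_eq_square algebra_simps)
    finally have ee: "2 * first_zero * fst z * fst z * ((d (fst z))\<^sup>2 + b (fst z) * e (fst z))
        = 2 * (first_zero * (fst z)\<^sup>2 * (d (fst z))\<^sup>2 - b (fst z) * d (fst z) - (b (fst z))\<^sup>2)"
      by (simp add: power2_eq_square algebra_simps)
    show ?thesis
      unfolding G_def G'_def K_def ee by (simp add: power2_eq_square algebra_simps)
  qed
  have contG: "continuous_on UNIV G" unfolding G_def by (intro continuous_intros; simp)
  have contK: "continuous_on UNIV K" unfolding K_def by (intro continuous_intros; simp)
  have range: "0 < first_zero * a\<^sup>2" "first_zero * a\<^sup>2 \<le> first_zero" if "(a, t) \<in> S" for a t
  proof -
    have "- 1 < a" "a < 0" using strip[OF that] by auto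
    then have "a\<^sup>2 \<le> 1" by (simp add: abs_square_le_1)
    then show "first_zero * a\<^sup>2 \<le> first_zero" using first_zero(1) mult_left_mono[of "a\<^sup>2" 1 first_zero] by simp
    show "0 < first_zero * a\<^sup>2" using \<open>a < 0\<close> first_zero(1) by simp
  qed
  have "(\<integral>z. indicator S z * (real DIM(real \<times> real) * G z + G' z z) \<partial>lborel) \<le> 0"
  proof (rule integral_dilation_generator_nonpos[OF S star derG])
    have "(\<lambda>z. G' z z) = (\<lambda>z. K z - 2 * G z)" using K by (auto simp: fun_eq_iff algebra_simps)
    moreover have "continuous_on UNIV (\<lambda>z. K z - 2 * G z)"
      by (intro continuous_intros contG contK)
    ultimately show "continuous_on UNIV (\<lambda>z. G' z z)" by (simp only:)
    show "G z \<le> 0" if "z \<in> S" for z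
    proof -
      have "0 \<le> b (fst z)" "d (fst z) \<le> 0"
        using range[of "fst z" "snd z"] that by (auto simp: b_def d_def intro!: bessel_sq_nonneg dbessel_sq_nonpos)
      then show ?thesis unfolding G_def by (intro mult_nonneg_nonpos) (auto simp: mult_le_0_iff)
    qed
  qed auto
  then have K0: "(\<integral>z. indicator S z * K z \<partial>lborel) \<le> 0" by (simp add: K)
  define E where "E z = 4 * first_zero\<^sup>2 * (fst z)\<^sup>2 * (d (fst z))\<^sup>2 * (1 - (snd z)\<^sup>2/3)\<^sup>2
            + 4/9 * (snd z)\<^sup>2 * (b (fst z))\<^sup>2 - 4 * first_zero * (b (fst z))\<^sup>2 * (1 - (snd z)\<^sup>2/3)\<^sup>2" for z :: "real \<times> real"
  define M where "M z = (snd z)\<^sup>2 * (b (fst z))\<^sup>2" for z :: "real \<times> real"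
  have intE: "integrable lborel (\<lambda>z. indicator S z * E z)"
    unfolding E_def by (intro integrable_bounded_set S continuous_intros; simp)
  have intM: "integrable lborel (\<lambda>z. indicator S z * M z)"
    unfolding M_def by (intro integrable_bounded_set S continuous_intros)
  have intK: "integrable lborel (\<lambda>z. indicator S z * K z)"
    by (intro integrable_bounded_set S contK)
  have pt: "E z + 4/3 * M z \<le> 2 * first_zero * K z" if z: "z \<in> S" for z
  proof -
    obtain a t where at: "z = (a, t)" by (cases z)
    have r: "0 < first_zero * a\<^sup>2" "first_zero * a\<^sup>2 \<le> first_zero" using range z at by auto
    have t2: "t\<^sup>2 \<le> 1" using strip[of a t] z at by (simp add: abs_square_le_1)
    have b0: "0 \<le> b a" "b a \<le> - d a"
      using bessel_sq_nonneg[of "first_zero * a\<^sup>2"] bessel_sq_plus_dbessel_sq_nonpos[of "first_zero * a\<^sup>2"] r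
      by (auto simp: b_def d_def)
    have bd: "(b a)\<^sup>2 \<le> - (b a * d a)"
      using mult_left_mono[OF b0(2,1)] by (simp add: power2_eq_square)
    have "2 * first_zero * K z - E z - 4/3 * M z
        = 8 * first_zero / 3 * t\<^sup>2 * (1 - t\<^sup>2/3) * (- (b a * d a)) - 16/9 * (t\<^sup>2 * (b a)\<^sup>2)"
      unfolding K_def E_def M_def at by (simp add: power2_eq_square field_simps)
    moreover have "8 * 1 / 3 * t\<^sup>2 * (1 - 1/3) * (b a)\<^sup>2 \<le> 8 * first_zero / 3 * t\<^sup>2 * (1 - t\<^sup>2/3) * (- (b a * d a))"
      by (intro mult_mono bd) (use first_zero_ge_1 t2 in auto)
    moreover have "8 * 1 / 3 * t\<^sup>2 * (1 - 1/3) * (b a)\<^sup>2 = 16/9 * (t\<^sup>2 * (b a)\<^sup>2)" by simp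
    ultimately show ?thesis by linarith
  qed
  have "?L + 4/3 * ?R = (\<integral>z. indicator S z * E z \<partial>lborel) + 4/3 * (\<integral>z. indicator S z * M z \<partial>lborel)"
    by (simp add: E_def M_def b_def d_def)
  also have "\<dots> = (\<integral>z. indicator S z * E z + 4/3 * (indicator S z * M z) \<partial>lborel)"
    using intE intM by simp
  also have "\<dots> \<le> (\<integral>z. 2 * first_zero * (indicator S z * K z) \<partial>lborel)"
    using intE intM intK pt by (intro integral_mono) (auto simp: indicator_def)
  also have "\<dots> \<le> 0" using K0 first_zero(1) by (simp add: mult_nonneg_nonpos)
  finally show ?thesis by simp
qed

section \<open>Second moments of vertical slices\<close>

text \<open>With \<open>r = 1 - x\<close> this says that the mean of \<open>r\<^sup>2\<close> with weight \<open>J0(j r)\<^sup>2\<close> on the unit interval is at least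
  \<open>1/16\<close>. The integrand is negative only for \<open>r < 1/4\<close>, where \<open>J0 \<le> 1\<close> is used; for
  \<open>1/4 \<le> r \<le> 3/4\<close> it is bounded below through \<open>J0(j r) \<ge> 1 - (3/2) r\<^sup>2\<close>, and for \<open>r \<ge> 3/4\<close> by zero.
  The two polynomial integrals are about \<open>-0.0104\<close> and \<open>0.0240\<close>.\<close>

lemma weighted_moment_nonneg:
  defines "p \<equiv> \<lambda>x. (bessel_sq (first_zero * (1 - x)\<^sup>2))\<^sup>2 * ((1 - x)\<^sup>2 - 1/16)"
  shows "0 \<le> integral {0..1} p"
proof -
  have c: "continuous_on A p" for A
  proof -
    have "continuous_on A (\<lambda>x. bessel_sq (first_zero * (1 - x)\<^sup>2))"
      by (rule continuous_on_compose2[OF continuous_bessel_sq[of UNIV]]) (auto intro!: continuous_intros)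
    then show ?thesis unfolding p_def by (intro continuous_intros)
  qed
  have i: "p integrable_on {a..b}" for a b
    by (rule integrable_continuous_real[OF c])
  have arg: "0 \<le> first_zero * (1 - x)\<^sup>2" "first_zero * (1 - x)\<^sup>2 \<le> first_zero" if "0 \<le> x" "x \<le> 1" for x
  proof -
    have "(1 - x)\<^sup>2 \<le> 1" using that by (intro power_le_one) auto
    then show "first_zero * (1 - x)\<^sup>2 \<le> first_zero" using first_zero(1) mult_left_mono[of "(1-x)\<^sup>2" 1 first_zero] by simp
  qed (use first_zero(1) in simp)
  have 1: "0 \<le> integral {0..1/4} p"
  proof (rule integral_nonneg[OF i])
    fix x :: real assume x: "x \<in> {0..1/4}"
    have "(1/4)\<^sup>2 \<le> (1 - x)\<^sup>2" by (rule power_mono) (use x in auto)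
    then show "0 \<le> p x" unfolding p_def by (intro mult_nonneg_nonneg) (auto simp: power_divide)
  qed
  \<comment> \<open>A primitive, in the variable \<open>r = 1 - x\<close>, of the expanded polynomial
    \<open>(1 - (3/2) r\<^sup>2)\<^sup>2 (r\<^sup>2 - 1/16)\<close>; hence the sign in the derivative of \<open>- P\<close> below.\<close>
  define P where "P x = (- 1/16 * (1 - x) + 19/48 * (1 - x)^3 - 201/320 * (1 - x)^5 + 9/28 * (1 - x)^7)" for x :: real
  define P' where "P' x = (1 - 3/2 * (1 - x)\<^sup>2)\<^sup>2 * ((1 - x)\<^sup>2 - 1/16)" for x :: real
  have P: "((\<lambda>x. - P x) has_real_derivative P' x) (at x within A)" for x A
  proof -
    have "((\<lambda>x. - P x) has_real_derivative
       - (1/16 - 19/16 * (1 - x)^2 + 201/64 * (1 - x)^4 - 9/4 * (1 - x)^6)) (at x within A)"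
      unfolding P_def by (auto intro!: derivative_eq_intros)
    moreover have "- (1/16 - 19/16 * (1 - x)^2 + 201/64 * (1 - x)^4 - 9/4 * (1 - x)^6) = - (- P' x)"
    proof -
      have "- (1/16 - 19/16 * y^2 + 201/64 * y^4 - 9/4 * y^6)
          = (1 - 3/2 * y\<^sup>2)\<^sup>2 * (y\<^sup>2 - 1/16)" for y :: real
        by (simp add: power2_eq_square eval_nat_numeral field_simps)
      then show ?thesis by (simp add: P'_def)
    qed
    ultimately show ?thesis by simp
  qed
  have hP: "(P' has_integral (- P (3/4) - - P (1/4))) {1/4..3/4}"
    by (rule fundamental_theorem_of_calculus)
       (auto simp: has_real_derivative_iff_has_vector_derivative[symmetric] intro: P)
  have 2: "- P (3/4) + P (1/4) \<le> integral {1/4..3/4} p"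
  proof -
    have "- P (3/4) - - P (1/4) \<le> integral {1/4..3/4} p"
    proof (rule has_integral_le[OF hP integrable_integral[OF i]])
      fix x :: real assume x: "x \<in> {1/4..3/4}"
      have r: "(1/4)\<^sup>2 \<le> (1 - x)\<^sup>2" "(1 - x)\<^sup>2 \<le> (3/4)\<^sup>2"
        by (rule power_mono; use x in auto)+
      have "1 - first_zero * (1 - x)\<^sup>2 \<le> bessel_sq (first_zero * (1 - x)\<^sup>2)"
        using arg[of x] x by (intro bessel_sq_ge) auto
      moreover have "first_zero * (1 - x)\<^sup>2 \<le> 3/2 * (1 - x)\<^sup>2"
        using first_zero(2) by (intro mult_right_mono) auto
      ultimately have "(1 - 3/2 * (1 - x)\<^sup>2)\<^sup>2 \<le> (bessel_sq (first_zero * (1 - x)\<^sup>2))\<^sup>2"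
        using r by (intro power_mono) (auto simp: power_divide)
      then show "P' x \<le> p x" unfolding P'_def p_def
        using r by (intro mult_right_mono) (auto simp: power_divide)
    qed
    then show ?thesis by simp
  qed
  define Q where "Q x = ((1 - x)^3 / 3 - (1 - x) / 16)" for x :: real
  have Q: "((\<lambda>x. - Q x) has_real_derivative ((1 - x)\<^sup>2 - 1/16)) (at x within A)" for x A
    unfolding Q_def by (auto intro!: derivative_eq_intros)
  have hQ: "((\<lambda>x. (1 - x)\<^sup>2 - 1/16) has_integral (- Q 1 - - Q (3/4))) {3/4..1}"
    by (rule fundamental_theorem_of_calculus)
       (auto simp: has_real_derivative_iff_has_vector_derivative[symmetric] intro: Q)
  have 3: "- Q 1 + Q (3/4) \<le> integral {3/4..1} p"
  proof -
    have "- Q 1 - - Q (3/4) \<le> integral {3/4..1} p"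
    proof (rule has_integral_le[OF hQ integrable_integral[OF i]])
      fix x :: real assume x: "x \<in> {3/4..1}"
      have r: "(1 - x)\<^sup>2 \<le> (1/4)\<^sup>2" by (rule power_mono) (use x in auto)
      have "(bessel_sq (first_zero * (1 - x)\<^sup>2))\<^sup>2 \<le> 1"
        using arg[of x] x by (intro power_le_one bessel_sq_nonneg bessel_sq_le_1) auto
      from mult_right_mono_neg[OF this, of "(1 - x)\<^sup>2 - 1/16"] r
      show "(1 - x)\<^sup>2 - 1/16 \<le> p x" unfolding p_def by (simp add: power_divide)
    qed
    then show ?thesis by simp
  qed
  have "integral {0..1} p = integral {0..1/4} p + integral {1/4..3/4} p + integral {3/4..1} p"
    using Henstock_Kurzweil_Integration.integral_combine[of 0 "1/4" 1 p] Henstock_Kurzweil_Integration.integral_combine[of "1/4" "3/4" 1 p] i by simp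
  moreover have "0 \<le> - P (3/4) + P (1/4) - Q 1 + Q (3/4)"
    by (simp add: P_def Q_def eval_nat_numeral)
  ultimately show ?thesis using 1 2 3 by linarith
qed

lemma centered_interval_moment:
  fixes h c :: real
  assumes "0 \<le> h"
  shows "(\<integral>t. indicator {-h<..<h} t * (t\<^sup>2 - c) \<partial>lborel) = 2 * h ^ 3 / 3 - 2 * h * c"
proof -
  have hi: "((\<lambda>t. t\<^sup>2 - c) has_integral ((h ^ 3 / 3 - c * h) - ((-h) ^ 3 / 3 - c * (-h)))) {-h..h}"
    using assms by (intro fundamental_theorem_of_calculus)
      (auto simp: has_real_derivative_iff_has_vector_derivative[symmetric] intro!: derivative_eq_intros)
  have "set_integrable lborel {-h..h} (\<lambda>t. t\<^sup>2 - c)"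
    unfolding set_integrable_def by (rule borel_integrable_compact) (auto intro!: continuous_intros)
  then have si: "set_integrable lborel {-h<..<h} (\<lambda>t. t\<^sup>2 - c)"
    by (rule set_integrable_subset) auto
  have "(\<integral>t. indicator {-h<..<h} t * (t\<^sup>2 - c) \<partial>lborel) = integral {-h<..<h} (\<lambda>t. t\<^sup>2 - c)"
    using set_borel_integral_eq_integral(2)[OF si] by (simp add: set_lebesgue_integral_def)
  also have "\<dots> = integral {-h..h} (\<lambda>t. t\<^sup>2 - c)"
    by (rule integral_open_interval_real[symmetric])
  also have "\<dots> = 2 * h ^ 3 / 3 - 2 * h * c"
    using integral_unique[OF hi] by (simp add: field_simps)
  finally show "(\<integral>t. indicator {-h<..<h} t * (t\<^sup>2 - c) \<partial>lborel) = 2 * h ^ 3 / 3 - 2 * h * c" .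
qed

text \<open>The domain in coordinates in which the diameter joins \<open>(-1, 0)\<close> to \<open>(1, 0)\<close>. The assumption \<open>star\<close>
  expresses that the vertex \<open>(1, 0)\<close> lies in the closure of the convex set, and \<open>strip\<close> contains
  what is used of the diameter being \<open>2\<close>. The second part of \<open>H\<close> says that the half-width is at least \<open>H\<close>.\<close>

locale normalized_domain =
  fixes W :: "(real \<times> real) set" and H :: real
  assumes W: "open W" "convex W" "bounded W"
    and strip: "\<And>s t. (s, t) \<in> W \<Longrightarrow> \<bar>s\<bar> < 1 \<and> \<bar>t\<bar> \<le> 1"
    and refl_fst: "\<And>s t. (s, t) \<in> W \<Longrightarrow> (- s, t) \<in> W"
    and refl_snd: "\<And>s t. (s, t) \<in> W \<Longrightarrow> (s, - t) \<in> W"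
    and star: "\<And>s t r. (s, t) \<in> W \<Longrightarrow> 0 < r \<Longrightarrow> r < 1 \<Longrightarrow> (1 - r * (1 - s), r * t) \<in> W"
    and H: "0 < H" "\<And>t. t < H \<Longrightarrow> \<exists>s t'. (s, t') \<in> W \<and> t < t'"
begin

definition right_half :: "(real \<times> real) set" where
  "right_half = {z \<in> W. 0 < fst z}"

lemma right_half: "right_half \<in> sets borel" "bounded right_half"
proof -
  have "open right_half" unfolding right_half_def using W(1)
    by (auto intro!: open_Collect_conj open_Collect_less continuous_intros)
  then show "right_half \<in> sets borel" by simp
  show "bounded right_half" by (rule bounded_subset[OF W(3)]) (auto simp: right_half_def)
qed

lemma vertical_segment:
  assumes "(s, t') \<in> W" "\<bar>t\<bar> \<le> t'" shows "(s, t) \<in> W"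
proof (cases "t' = 0")
  case False
  then have t': "0 < t'" using assms(2) by simp
  define u where "u = (1 + t / t') / 2"
  have u: "0 \<le> u" "u \<le> 1" using assms(2) t' by (auto simp: u_def field_simps abs_le_iff)
  have "u *\<^sub>R (s, t') + (1 - u) *\<^sub>R (s, - t') \<in> W"
    using convexD[OF W(2) assms(1) refl_snd[OF assms(1)]] u by simp
  moreover have "u *\<^sub>R (s, t') + (1 - u) *\<^sub>R (s, - t') = (s, t)"
    using t' by (simp add: u_def field_simps)
  ultimately show ?thesis by simp
qed (use assms in simp)

lemma horizontal_segment:
  assumes "(s', t) \<in> W" "\<bar>s\<bar> \<le> s'" shows "(s, t) \<in> W"
proof (cases "s' = 0")
  case False
  then have s': "0 < s'" using assms(2) by simp
  define u where "u = (1 + s / s') / 2"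
  have u: "0 \<le> u" "u \<le> 1" using assms(2) s' by (auto simp: u_def field_simps abs_le_iff)
  have "u *\<^sub>R (s', t) + (1 - u) *\<^sub>R (- s', t) \<in> W"
    using convexD[OF W(2) assms(1) refl_fst[OF assms(1)]] u by simp
  moreover have "u *\<^sub>R (s', t) + (1 - u) *\<^sub>R (- s', t) = (s, t)"
    using s' by (simp add: u_def field_simps)
  ultimately show ?thesis by simp
qed (use assms in simp)

text \<open>Points close to the top of the domain are moved to the line \<open>s = 0\<close> by the symmetry in \<open>s\<close> and
  convexity.\<close>

lemma minor_axis:
  assumes "\<bar>t\<bar> < H" shows "(0, t) \<in> W"
proof -
  obtain s t' where st: "(s, t') \<in> W" "\<bar>t\<bar> < t'" using H(2)[OF assms] by blast
  have "(\<bar>s\<bar>, t') \<in> W" using st(1) refl_fst[OF st(1)] by (cases "0 \<le> s") auto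
  then have "(0, t') \<in> W" by (rule horizontal_segment) simp
  then show ?thesis by (rule vertical_segment) (use st(2) in simp)
qed

text \<open>Convexity puts the rhombus spanned by the two axes inside the domain. It is the extremal shape
  for the lower bound on slices.\<close>

lemma rhombus:
  assumes "0 < s" "s < 1" "\<bar>t\<bar> < H * (1 - s)" shows "(s, t) \<in> W"
proof -
  have "\<bar>t / (1 - s)\<bar> < H" using assms by (simp add: field_simps)
  from star[OF minor_axis[OF this], of "1 - s"] assms show ?thesis by simp
qed

definition height :: "real \<Rightarrow> real" where
  "height s = Sup {t. (s, t) \<in> W}"

lemma vertical_slice:
  assumes "0 < s" "s < 1"
  shows "(s, t) \<in> W \<longleftrightarrow> \<bar>t\<bar> < height s"
proof
  have bdd: "bdd_above {t. (s, t) \<in> W}"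
    using strip by (auto intro!: bdd_aboveI[of _ 1] simp: abs_le_iff)
  have "(s, 0) \<in> W" using assms H(1) by (intro rhombus) auto
  then have ne: "{t. (s, t) \<in> W} \<noteq> {}" by auto
  have up: "t < height s" if t: "(s, t) \<in> W" for t
  proof -
    have "open ((\<lambda>t. (s, t)) -` W)" by (rule open_vimage[OF W(1)]) (auto intro!: continuous_intros)
    moreover have "t \<in> (\<lambda>t. (s, t)) -` W" using t by simp
    ultimately obtain e where e: "0 < e" "ball t e \<subseteq> (\<lambda>t. (s, t)) -` W"
      by (rule openE)
    then have "(s, t + e/2) \<in> W" by (auto simp: subset_iff dist_real_def)
    then have "t + e/2 \<le> height s" unfolding height_def by (intro cSup_upper bdd) auto
    then show ?thesis using e(1) by simp
  qed
  show "\<bar>t\<bar> < height s" if "(s, t) \<in> W"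
    using up[OF that] up[OF refl_snd[OF that]] by (simp add: abs_less_iff)
  show "(s, t) \<in> W" if less: "\<bar>t\<bar> < height s"
  proof -
    obtain t' where "(s, t') \<in> W" "\<bar>t\<bar> < t'"
      using less less_cSup_iff[OF ne bdd] by (auto simp: height_def)
    then show ?thesis using vertical_segment by fastforce
  qed
qed

lemma height_lower:
  assumes "0 < s" "s < 1" shows "H * (1 - s) \<le> height s"
proof (rule dense_le_bounded[of 0])
  show "0 < H * (1 - s)" using assms H(1) by simp
  show "t \<le> height s" if "0 < t" "t < H * (1 - s)" for t
    using rhombus[OF assms, of t] vertical_slice[OF assms, of t] that by auto
qed

lemma height_pos: "0 < s \<Longrightarrow> s < 1 \<Longrightarrow> 0 < height s"
  using height_lower[of s] H(1) by (smt (verit) mult_pos_pos)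

lemma height_antimono:
  assumes "0 < s" "s \<le> s'" "s' < 1" shows "height s' \<le> height s"
proof (rule ccontr)
  assume "\<not> height s' \<le> height s"
  then have "(s', height s) \<in> W"
    using height_pos[of s] assms by (subst vertical_slice) auto
  then have "(s, height s) \<in> W" by (rule horizontal_segment) (use assms in simp)
  then show False using vertical_slice[of s "height s"] assms by auto
qed

text \<open>Slicing at constant \<open>s\<close> with \<open>r = 1 - s\<close>, the difference of the two sides is the integral of
  \<open>(2/3) h (h\<^sup>2 - H\<^sup>2/16)\<close> times the weight, and \<open>h \<ge> H r\<close> bounds this below by
  \<open>(2/3) H\<^sup>2 h (r\<^sup>2 - 1/16)\<close>. The last factor changes sign at \<open>r = 1/4\<close>, and \<open>h\<close> increases with \<open>r\<close>, so
  \<open>h\<close> may be replaced by its value there, \<open>height (3/4)\<close>.\<close>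

lemma second_moment_estimate:
  defines "b \<equiv> \<lambda>s. (bessel_sq (first_zero * (1 - s)\<^sup>2))\<^sup>2"
  shows "H\<^sup>2 / 48 * (\<integral>z. indicator right_half z * b (fst z) \<partial>lborel)
    \<le> (\<integral>z. indicator right_half z * ((snd z)\<^sup>2 * b (fst z)) \<partial>lborel)"
proof -
  have contb: "continuous_on A b" for A
    unfolding b_def by (intro continuous_intros continuous_on_compose2[OF continuous_bessel_sq[of UNIV]]) auto
  have contb2: "continuous_on A (\<lambda>z. b (fst z))" for A :: "(real \<times> real) set"
    by (rule continuous_on_compose2[OF contb[of UNIV]]) (auto intro!: continuous_intros)
  define c where "c = H\<^sup>2 / 48"
  define g where "g z = indicator right_half z * (((snd z)\<^sup>2 - c) * b (fst z))" for z :: "real \<times> real"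
  define p where "p s = b s * ((1 - s)\<^sup>2 - 1/16)" for s
  define C where "C = 2 * H\<^sup>2 / 3 * height (3/4)"
  have "0 \<le> C" using height_pos[of "3/4"] by (simp add: C_def)
  have int_g: "integrable lborel g"
    unfolding g_def by (intro integrable_bounded_set right_half continuous_intros contb2)
  have b0: "0 \<le> b s" for s by (simp add: b_def)
  have inner: "indicator {0..1} s * (C * p s) \<le> (\<integral>t. g (s, t) \<partial>lborel)" for s
  proof (cases "0 < s \<and> s < 1")
    case True
    then have s: "0 < s" "s < 1" by auto
    have "g (s, t) = b s * (indicator {-height s<..<height s} t * (t\<^sup>2 - c))" for t
      using vertical_slice[OF s, of t] s(1) by (auto simp: g_def right_half_def indicator_def)
    then have "(\<integral>t. g (s, t) \<partial>lborel)
        = b s * (\<integral>t. indicator {-height s<..<height s} t * (t\<^sup>2 - c) \<partial>lborel)" by simp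
    also have "\<dots> = b s * (2 * height s ^ 3 / 3 - 2 * height s * c)"
      using height_pos[OF s] by (subst centered_interval_moment) auto
    also have "\<dots> = b s * (2 / 3 * height s * ((height s)\<^sup>2 - H\<^sup>2/16))"
      by (simp add: c_def power3_eq_cube power2_eq_square field_simps)
    finally have eq: "(\<integral>t. g (s, t) \<partial>lborel) = b s * (2 / 3 * height s * ((height s)\<^sup>2 - H\<^sup>2/16))" .
    have "(H * (1 - s))\<^sup>2 \<le> (height s)\<^sup>2"
      using height_lower[OF s] H(1) s by (intro power_mono) auto
    then have "H\<^sup>2 * (1 - s)\<^sup>2 \<le> (height s)\<^sup>2" by (simp add: power_mult_distrib)
    then have 1: "2 / 3 * height s * (H\<^sup>2 * ((1 - s)\<^sup>2 - 1/16))
        \<le> 2 / 3 * height s * ((height s)\<^sup>2 - H\<^sup>2/16)"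
      using height_pos[OF s] by (intro mult_left_mono) (auto simp: right_diff_distrib)
    have "height (3/4) * ((1 - s)\<^sup>2 - 1/16) \<le> height s * ((1 - s)\<^sup>2 - 1/16)"
    proof (cases "s \<le> 3/4")
      case True
      have "(1/4)\<^sup>2 \<le> (1 - s)\<^sup>2" by (rule power_mono) (use True in auto)
      then show ?thesis using height_antimono[of s "3/4"] s True
        by (intro mult_right_mono) (auto simp: power_divide)
    next
      case False
      have "(1 - s)\<^sup>2 \<le> (1/4)\<^sup>2" by (rule power_mono) (use False s in auto)
      then show ?thesis using height_antimono[of "3/4" s] s False
        by (intro mult_right_mono_neg) (auto simp: power_divide)
    qed
    from mult_left_mono[OF this, of "2 / 3 * H\<^sup>2"]
    have "2 / 3 * H\<^sup>2 * (height (3/4) * ((1 - s)\<^sup>2 - 1/16))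
        \<le> 2 / 3 * H\<^sup>2 * (height s * ((1 - s)\<^sup>2 - 1/16))" by simp
    moreover have "C * x = 2 / 3 * H\<^sup>2 * (height (3/4) * x)"
      "2 / 3 * height s * (H\<^sup>2 * x) = 2 / 3 * H\<^sup>2 * (height s * x)" for x
      by (simp_all add: C_def)
    ultimately have "C * ((1 - s)\<^sup>2 - 1/16) \<le> 2 / 3 * height s * (H\<^sup>2 * ((1 - s)\<^sup>2 - 1/16))"
      by (simp only:)
    then have "C * ((1 - s)\<^sup>2 - 1/16) \<le> 2 / 3 * height s * ((height s)\<^sup>2 - H\<^sup>2/16)"
      using 1 by (rule order.trans)
    from mult_left_mono[OF this b0[of s]]
    have "b s * (C * ((1 - s)\<^sup>2 - 1/16)) \<le> (\<integral>t. g (s, t) \<partial>lborel)" by (simp only: eq)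
    moreover have "indicator {0..1} s * (C * p s) = b s * (C * ((1 - s)\<^sup>2 - 1/16))"
      using s by (simp add: p_def)
    ultimately show ?thesis by (simp only:)
  next
    case False
    have "g (s, t) = 0" for t
      using False strip[of s t] by (auto simp: g_def right_half_def indicator_def)
    moreover have "indicator {0..1} s * (C * p s) \<le> 0"
    proof -
      consider "s \<notin> {0..1}" | "s = 0" | "s = 1" using False by force
      then show ?thesis
      proof cases
        case 3
        then show ?thesis using \<open>0 \<le> C\<close> by (simp add: p_def b_def bessel_sq_0)
      qed (simp_all add: p_def b_def first_zero(3))
    qed
    ultimately show ?thesis by simp
  qed
  have si: "set_integrable lborel {0..1} p"
    unfolding set_integrable_def p_def
    by (rule borel_integrable_compact) (auto intro!: continuous_intros contb)
  have "0 \<le> integral {0..1} p"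
    using weighted_moment_nonneg by (simp add: p_def [abs_def] b_def)
  then have "0 \<le> C * (\<integral>s. indicator {0..1} s * p s \<partial>lborel)"
    using \<open>0 \<le> C\<close> set_borel_integral_eq_integral(2)[OF si] by (simp add: set_lebesgue_integral_def)
  also have "\<dots> = (\<integral>s. C * (indicator {0..1} s * p s) \<partial>lborel)"
    by (rule integral_mult_right_zero[symmetric])
  also have "\<dots> \<le> (\<integral>s. \<integral>t. g (s, t) \<partial>lborel \<partial>lborel)"
  proof (rule integral_mono)
    show "integrable lborel (\<lambda>s. C * (indicator {0..1} s * p s))"
      using si by (intro integrable_mult_right) (simp add: set_integrable_def)
    show "integrable lborel (\<lambda>s. \<integral>t. g (s, t) \<partial>lborel)" by (rule fubini_real2(1)[OF int_g])
    show "C * (indicator {0..1} s * p s) \<le> (\<integral>t. g (s, t) \<partial>lborel)" for s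
      using inner[of s] by (simp only: mult.left_commute)
  qed
  also have "\<dots> = integral\<^sup>L lborel g" by (rule fubini_real2(2)[OF int_g, symmetric])
  also have "\<dots> = (\<integral>z. indicator right_half z * ((snd z)\<^sup>2 * b (fst z))
      - c * (indicator right_half z * b (fst z)) \<partial>lborel)"
    by (rule arg_cong[where f = "integral\<^sup>L lborel"]) (simp add: g_def fun_eq_iff algebra_simps)
  also have "\<dots> = (\<integral>z. indicator right_half z * ((snd z)\<^sup>2 * b (fst z)) \<partial>lborel)
      - c * (\<integral>z. indicator right_half z * b (fst z) \<partial>lborel)"
    by (subst Bochner_Integration.integral_diff)
       (auto intro!: integrable_mult_right integrable_bounded_set right_half continuous_intros contb2)
  finally show ?thesis by (simp add: c_def)
qed

text \<open>The integrand of the numerator of the Rayleigh quotient of \<open>F(s) (1 - t\<^sup>2/3)\<close> minus the claimed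
  bound times that of the denominator.\<close>

definition excess :: "real \<times> real \<Rightarrow> real" where
  "excess z = (dprofile (fst z))\<^sup>2 * (1 - (snd z)\<^sup>2/3)\<^sup>2 + 4/9 * (snd z)\<^sup>2 * (profile (fst z))\<^sup>2
     - (4 * first_zero - 0.027 * H\<^sup>2) * ((profile (fst z))\<^sup>2 * (1 - (snd z)\<^sup>2/3)\<^sup>2)"

lemma continuous_excess: "continuous_on UNIV excess"
proof -
  have "continuous_on UNIV (\<lambda>z :: real \<times> real. profile (fst z))"
    "continuous_on UNIV (\<lambda>z :: real \<times> real. dprofile (fst z))"
    by (auto intro!: continuous_on_compose2[OF continuous_profile]
        continuous_on_compose2[OF continuous_dprofile] continuous_intros)
  then show ?thesis unfolding excess_def by (intro continuous_intros; simp)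
qed

text \<open>The gain \<open>(4/3) \<integral> t\<^sup>2 f\<^sup>2\<close> of \<open>radial_estimate\<close> is at least \<open>(4/3) (H\<^sup>2/48) \<integral> f\<^sup>2\<close>, and \<open>f\<^sup>2 \<ge> u\<^sup>2\<close>. The
  constant \<open>0.027\<close> is a quarter of \<open>0.108\<close> and is less than \<open>1/36\<close>.\<close>

lemma integral_excess_right_half: "(\<integral>z. indicator right_half z * excess z \<partial>lborel) \<le> 0"
proof -
  define b where "b s = bessel_sq (first_zero * (1 - s)\<^sup>2)" for s
  define d where "d s = dbessel_sq (first_zero * (1 - s)\<^sup>2)" for s
  \<comment> \<open>The half domain with its vertex moved to the origin.\<close>
  define S where "S = (\<lambda>z. (1, 0) + z) -` right_half"
  have "continuous_on UNIV (\<lambda>z. (1, 0) + z :: real \<times> real)" by (intro continuous_intros)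
  then have mb: "(\<lambda>z. (1, 0) + z :: real \<times> real) \<in> borel_measurable borel"
    by (rule borel_measurable_continuous_onI)
  have S: "S \<in> sets borel" "bounded S"
  proof -
    show "S \<in> sets borel"
      using measurable_sets[OF mb right_half(1)] by (simp add: S_def)
    have "S = (\<lambda>z. (-1, 0) + z) ` right_half" by (force simp: S_def image_iff)
    then show "bounded S" using bounded_translation[OF right_half(2)] by simp
  qed
  have shift: "(\<integral>z. indicator right_half z * f z \<partial>lborel) = (\<integral>z. indicator S z * f ((1, 0) + z) \<partial>lborel)"
    if f: "continuous_on UNIV f" for f :: "real \<times> real \<Rightarrow> real"
  proof -
    have [measurable]: "f \<in> borel_measurable borel" "right_half \<in> sets borel"
      using f right_half by (simp_all add: borel_measurable_continuous_onI)
    have "(\<integral>z. indicator right_half z * f z \<partial>lborel)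
        = (\<integral>z. indicator right_half z * f z \<partial>distr lborel borel ((+) (1, 0)))"
      by (simp add: lborel_distr_plus)
    also have "\<dots> = (\<integral>z. indicator S z * f ((1, 0) + z) \<partial>lborel)"
      using mb by (subst integral_distr) (auto simp: S_def indicator_def)
    finally show ?thesis .
  qed
  have contb: "continuous_on A b" and contd: "continuous_on A d" for A
    unfolding b_def d_def
    by (intro continuous_intros continuous_on_compose2[OF continuous_bessel_sq[of UNIV]]
        continuous_on_compose2[OF continuous_dbessel_sq[of UNIV]]; auto)+
  have contb2 [continuous_intros]: "continuous_on A (\<lambda>z. b (fst z))"
    and contd2 [continuous_intros]: "continuous_on A (\<lambda>z. d (fst z))" for A :: "(real \<times> real) set"
    by (auto intro!: continuous_on_compose2[OF contb[of UNIV]] continuous_on_compose2[OF contd[of UNIV]] continuous_intros)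
  define E where "E z = 4 * first_zero\<^sup>2 * (1 - fst z)\<^sup>2 * (d (fst z))\<^sup>2 * (1 - (snd z)\<^sup>2/3)\<^sup>2
            + 4/9 * (snd z)\<^sup>2 * (b (fst z))\<^sup>2 - 4 * first_zero * (b (fst z))\<^sup>2 * (1 - (snd z)\<^sup>2/3)\<^sup>2" for z :: "real \<times> real"
  have contE: "continuous_on UNIV E" unfolding E_def by (intro continuous_intros; simp)
  have "(\<integral>z. indicator right_half z * E z \<partial>lborel)
      \<le> - (4/3) * (\<integral>z. indicator right_half z * ((snd z)\<^sup>2 * (b (fst z))\<^sup>2) \<partial>lborel)"
  proof -
    have "t *\<^sub>R z \<in> S" if "z \<in> S" "0 < t" "t < 1" for z t
    proof -
      obtain a y where z: "z = (a, y)" by (cases z)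
      have w: "(1 + a, y) \<in> W" "- 1 < a" using that(1) by (auto simp: S_def right_half_def z)
      have "- 1 < t * a" using that w strip[OF w(1)] by (smt (verit) mult_less_cancel_right2 mult_nonneg_nonneg)
      then show ?thesis using star[OF w(1) that(2,3)] by (simp add: S_def right_half_def z)
    qed
    moreover have "- 1 < a \<and> a < 0 \<and> \<bar>t\<bar> \<le> 1" if "(a, t) \<in> S" for a t
      using that strip[of "1 + a" t] by (auto simp: S_def right_half_def)
    moreover have c2: "continuous_on UNIV (\<lambda>z. (snd z)\<^sup>2 * (b (fst z))\<^sup>2)" by (intro continuous_intros)
    ultimately show ?thesis
      unfolding shift[OF contE] shift[OF c2]
      using radial_estimate[OF S] by (simp add: E_def b_def d_def)
  qed
  moreover have "H\<^sup>2 / 48 * (\<integral>z. indicator right_half z * (b (fst z))\<^sup>2 \<partial>lborel)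
      \<le> (\<integral>z. indicator right_half z * ((snd z)\<^sup>2 * (b (fst z))\<^sup>2) \<partial>lborel)"
    using second_moment_estimate by (simp add: b_def)
  ultimately have main: "(\<integral>z. indicator right_half z * E z \<partial>lborel)
      + H\<^sup>2 / 36 * (\<integral>z. indicator right_half z * (b (fst z))\<^sup>2 \<partial>lborel) \<le> 0"
    by simp
  have int1: "integrable lborel (\<lambda>z. indicator right_half z * E z)"
    by (intro integrable_bounded_set right_half contE)
  have int2: "integrable lborel (\<lambda>z. indicator right_half z * (b (fst z))\<^sup>2)"
    by (intro integrable_bounded_set right_half continuous_intros)
  have "(\<integral>z. indicator right_half z * excess z \<partial>lborel)
      \<le> (\<integral>z. indicator right_half z * E z + H\<^sup>2 / 36 * (indicator right_half z * (b (fst z))\<^sup>2) \<partial>lborel)"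
  proof (rule integral_mono)
    show "integrable lborel (\<lambda>z. indicator right_half z * excess z)"
      by (intro integrable_bounded_set right_half continuous_excess)
    show "integrable lborel (\<lambda>z. indicator right_half z * E z + H\<^sup>2 / 36 * (indicator right_half z * (b (fst z))\<^sup>2))"
      using int1 int2 by simp
    fix z :: "real \<times> real"
    show "indicator right_half z * excess z
        \<le> indicator right_half z * E z + H\<^sup>2 / 36 * (indicator right_half z * (b (fst z))\<^sup>2)"
    proof (cases "z \<in> right_half")
      case True
      obtain s t where z: "z = (s, t)" by (cases z)
      have s: "0 < s" "s < 1" and t: "\<bar>t\<bar> \<le> 1"
        using True strip[of s t] by (auto simp: right_half_def z)
      have "t\<^sup>2 \<le> 1" using t by (simp add: abs_square_le_1)
      then have q: "(1 - t\<^sup>2/3)\<^sup>2 \<le> 1" by (intro power_le_one) auto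
      have pr: "profile s = b s" "dprofile s = - 2 * first_zero * (1 - s) * d s"
        using s by (auto simp: profile_def dprofile_def b_def d_def)
      have "E z + H\<^sup>2 / 36 * (b s)\<^sup>2 - excess z = H\<^sup>2 * (b s)\<^sup>2 * (1/36 - 0.027 * (1 - t\<^sup>2/3)\<^sup>2)"
      proof -
        have "4 * m\<^sup>2 * x\<^sup>2 * y\<^sup>2 * q + 4/9 * t2 * B - 4 * m * B * q + h / 36 * B
            - ((- 2 * m * x * y)\<^sup>2 * q + 4/9 * t2 * B - (4 * m - 0.027 * h) * (B * q))
            = h * B * (1/36 - 0.027 * q)" for m x y q t2 B h :: real
          by (simp add: power_mult_distrib algebra_simps)
        then show ?thesis unfolding E_def excess_def z fst_conv snd_conv pr .
      qed
      moreover have "0 \<le> H\<^sup>2 * (b s)\<^sup>2 * (1/36 - 0.027 * (1 - t\<^sup>2/3)\<^sup>2)"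
        using q by (intro mult_nonneg_nonneg) auto
      ultimately have "excess z \<le> E z + H\<^sup>2 / 36 * (b s)\<^sup>2" by linarith
      then show ?thesis using True by (simp add: z)
    qed simp
  qed
  also have "\<dots> = (\<integral>z. indicator right_half z * E z \<partial>lborel)
      + H\<^sup>2 / 36 * (\<integral>z. indicator right_half z * (b (fst z))\<^sup>2 \<partial>lborel)"
    using int1 int2 by simp
  finally show ?thesis using main by linarith
qed

text \<open>The integrand is even in \<open>s\<close>, and the line \<open>s = 0\<close> that separates the two halves is a null set.\<close>

lemma integral_excess: "(\<integral>z. indicator W z * excess z \<partial>lborel) \<le> 0"
proof -
  have [measurable]: "excess \<in> borel_measurable borel" "W \<in> sets borel" "right_half \<in> sets borel"
    using continuous_excess W right_half by (simp_all add: borel_measurable_continuous_onI)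
  define f where "f z = indicator right_half z * excess z" for z
  have mf: "f \<in> borel_measurable borel" unfolding f_def by measurable
  have mr: "(\<lambda>z :: real \<times> real. (- fst z, snd z)) \<in> borel_measurable borel"
    by (intro borel_measurable_continuous_onI continuous_intros)
  define L where "L = {z :: real \<times> real. (1, 0) \<bullet> z = 0}"
  have "negligible L" unfolding L_def by (rule negligible_hyperplane) (simp add: zero_prod_def)
  moreover have "closed L" unfolding L_def by (rule closed_hyperplane)
  ultimately have "emeasure lborel L = 0"
    by (simp add: negligible_iff_null_sets null_sets_completion_iff null_setsD1)
  then have "AE z in lborel. z \<notin> L"
    using \<open>closed L\<close> by (intro AE_not_in) (simp add: null_sets_def)
  then have "AE z in lborel. indicator W z * excess z = f z + f (- fst z, snd z)"
  proof eventually_elim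
    case (elim z)
    obtain s t where z: "z = (s, t)" by (cases z)
    have "(- s, t) \<in> W \<longleftrightarrow> (s, t) \<in> W" using refl_fst[of s t] refl_fst[of "- s" t] by auto
    moreover have "excess (- s, t) = excess (s, t)"
      by (simp add: excess_def profile_def dprofile_def sgn_minus)
    ultimately show ?case using elim by (auto simp: f_def right_half_def L_def z indicator_def)
  qed
  then have "(\<integral>z. indicator W z * excess z \<partial>lborel) = (\<integral>z. f z + f (- fst z, snd z) \<partial>lborel)"
    by (intro integral_cong_AE) (use mf mr in \<open>auto intro!: measurable_compose[OF mr mf] borel_measurable_add\<close>)
  also have "\<dots> = integral\<^sup>L lborel f + (\<integral>z. f (- fst z, snd z) \<partial>lborel)"
  proof (rule Bochner_Integration.integral_add)
    show "integrable lborel f"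
      unfolding f_def by (intro integrable_bounded_set right_half continuous_excess)
    define R where "R = (\<lambda>z. (- fst z, snd z)) -` right_half"
    have "R \<in> sets borel" using measurable_sets[OF mr right_half(1)] by (simp add: R_def)
    moreover have "bounded R"
      by (rule bounded_subset[OF W(3)]) (use refl_fst in \<open>force simp: R_def right_half_def\<close>)
    ultimately have "integrable lborel (\<lambda>z. indicator R z * excess (- fst z, snd z))"
      by (intro integrable_bounded_set continuous_on_compose2[OF continuous_excess])
         (auto intro!: continuous_intros)
    then show "integrable lborel (\<lambda>z. f (- fst z, snd z))"
      by (simp add: f_def R_def indicator_def)
  qed
  also have "\<dots> = 2 * integral\<^sup>L lborel f"
    by (simp add: integral_reflect_fst[OF mf])
  finally show ?thesis using integral_excess_right_half unfolding f_def [abs_def] by simp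
qed

end

section \<open>The eigenvalue bound\<close>

text \<open>It remains to choose the coordinates. The origin is the midpoint \<open>m\<close> of the diameter, and the axes
  are spanned by \<open>v = (b - a)/2\<close> and by \<open>e\<close> scaled to the length of \<open>v\<close>. Since \<open>v\<close> has length
  \<open>D/2\<close>, this turns \<open>D\<close> into \<open>2\<close> and the width into \<open>2 H\<close>.\<close>

theorem theorem1p3:
  fixes \<Omega> :: "(real ^ 2) set" and a b e q :: "real ^ 2"
  assumes "\<Omega> \<noteq> {}" and "bounded \<Omega>" and "open \<Omega>" and "convex \<Omega>"
    and "a \<in> closure \<Omega>" and "b \<in> closure \<Omega>" and "dist a b = diameter \<Omega>"
    and "norm e = 1" and "e \<bullet> (b - a) = 0"
    and "symmetric_about \<Omega> (midpoint a b) (b - a)"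
    and "symmetric_about \<Omega> q e"
  shows "(diameter \<Omega>)\<^sup>2 * neumann_mu1 \<Omega>
           \<le> 4 * j01\<^sup>2 - 0.108 * ((width \<Omega> e)\<^sup>2 / (diameter \<Omega>)\<^sup>2)"
proof -
  define m where "m = midpoint a b"
  define v where "v = (1/2) *\<^sub>R (b - a)"
  define L where "L = norm v"
  define T where "T z = m + fst z *\<^sub>R v + snd z *\<^sub>R (L *\<^sub>R e)" for z :: "real \<times> real"
  have ab: "a = m - v" "b = m + v" "b - a = 2 *\<^sub>R v"
    by (simp_all add: m_def v_def midpoint_def vec_eq_iff field_simps)
  have diam: "diameter \<Omega> = 2 * L"
    using assms(7) dist_commute[of b a] by (simp add: dist_norm[of b a] ab(3) L_def)
  have "L \<noteq> 0"
  proof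
    assume "L = 0"
    obtain x where x: "x \<in> \<Omega>" using assms(1) by auto
    have "\<Omega> \<subseteq> {x}"
      using diameter_bounded_bound[OF assms(2) x] diam \<open>L = 0\<close> by force
    then have "\<Omega> = {x}" using x by auto
    then show False using assms(3) not_open_singleton by metis
  qed
  then have L: "0 < L" "v \<noteq> 0" by (auto simp: L_def)
  have ee: "e \<bullet> e = 1" using assms(8) by (simp add: dot_square_norm)
  have vv: "v \<bullet> v = L\<^sup>2" by (simp add: L_def dot_square_norm)
  have ev: "e \<bullet> v = 0" "v \<bullet> e = 0" using assms(9) unfolding ab(3) by (simp_all add: inner_commute)
  have dT: "dist (T (s, t)) (T (s', t')) = norm ((s - s') *\<^sub>R v + (t - t') *\<^sub>R (L *\<^sub>R e))" for s t s' t'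
    by (simp add: T_def dist_norm algebra_simps)
  define X where "X P = ((P - m) \<bullet> v) / L\<^sup>2" for P
  define Y where "Y P = ((P - m) \<bullet> e) / L" for P
  have XT: "X (T z) = fst z" and YT: "Y (T z) = snd z" for z
    using L by (simp_all add: X_def Y_def T_def inner_add_left ev vv ee)
  \<comment> \<open>The difference \<open>d\<close> is orthogonal to \<open>v\<close> and \<open>e\<close>, and the determinant of these two vectors
    does not vanish because its square is \<open>|v|\<^sup>2 |e|\<^sup>2\<close>.\<close>
  have TXY: "T (X P, Y P) = P" for P
  proof -
    define d where "d = P - T (X P, Y P)"
    have "d \<bullet> v = L\<^sup>2 * (X P - X (T (X P, Y P)))" "d \<bullet> e = L * (Y P - Y (T (X P, Y P)))"
      using L by (simp_all add: d_def X_def Y_def inner_diff_left diff_divide_distrib [symmetric])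
    then have d: "d $ 1 * v $ 1 + d $ 2 * v $ 2 = 0" "d $ 1 * e $ 1 + d $ 2 * e $ 2 = 0"
      by (simp_all add: XT YT inner_vec_def sum_2)
    define D where "D = v $ 1 * e $ 2 - v $ 2 * e $ 1"
    have "D\<^sup>2 = (v \<bullet> v) * (e \<bullet> e) - (v \<bullet> e)\<^sup>2"
      by (simp add: D_def inner_vec_def sum_2 power2_eq_square algebra_simps)
    then have "D \<noteq> 0" using L by (auto simp: vv ee ev)
    moreover have "d $ 1 * D = 0" "d $ 2 * D = 0"
      using d unfolding D_def by algebra+
    ultimately have "d = 0" by (simp add: vec_eq_iff forall_2)
    then show ?thesis by (simp add: d_def)
  qed
  define W where "W = T -` \<Omega>"
  have contT: "continuous_on UNIV T" unfolding T_def by (intro continuous_intros)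

  have reflv: "reflection (midpoint a b) (b - a) (T (s, t)) = T (- s, t)" for s t
  proof -
    have "(T (s, t) - m) \<bullet> v = s * L\<^sup>2" by (simp add: T_def inner_add_left ev vv)
    then have "2 * ((T (s, t) - m) \<bullet> (2 *\<^sub>R v)) / ((2 *\<^sub>R v) \<bullet> (2 *\<^sub>R v)) = s"
      using L by (simp add: vv)
    then have "reflection (midpoint a b) (b - a) (T (s, t)) = T (s, t) - s *\<^sub>R (2 *\<^sub>R v)"
      unfolding reflection_def ab(3) m_def[symmetric] by (simp only:)
    also have "\<dots> = T (- s, t)" by (simp add: T_def vec_eq_iff algebra_simps)
    finally show ?thesis .
  qed
  have refl_fst: "(- s, t) \<in> W" if "(s, t) \<in> W" for s t
  proof -
    have "reflection (midpoint a b) (b - a) (T (s, t)) \<in> \<Omega>"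
      using assms(10) that unfolding symmetric_about_def W_def by auto
    then show ?thesis by (simp add: reflv W_def)
  qed
  \<comment> \<open>The axis with normal \<open>e\<close> must contain the diameter: at signed distance \<open>\<delta>\<close> from it, the mirror image of
    \<open>a\<close> would have the distance \<open>sqrt (D\<^sup>2 + 4 \<delta>\<^sup>2)\<close> from \<open>b\<close>.\<close>
  define \<delta> where "\<delta> = (q - m) \<bullet> e"
  have refle: "reflection q e P = P - (2 * ((P - m) \<bullet> e - \<delta>)) *\<^sub>R e" for P
    by (simp add: reflection_def ee \<delta>_def inner_diff_left)
  have "\<delta> = 0"
  proof -
    have "reflection q e ` closure \<Omega> \<subseteq> closure \<Omega>"
    proof -
      have "continuous_on UNIV (reflection q e)"
        unfolding refle [abs_def] by (intro continuous_intros)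
      then have "reflection q e ` closure \<Omega> \<subseteq> closure (reflection q e ` \<Omega>)"
        by (rule continuous_image_closure_subset) simp
      then show ?thesis using assms(11) by (simp add: symmetric_about_def)
    qed
    then have "reflection q e a \<in> closure \<Omega>" using assms(5) by blast
    moreover have "reflection q e a = a + (2 * \<delta>) *\<^sub>R e"
      by (simp add: refle ab(1) inner_diff_left ev)
    ultimately have "dist b (a + (2 * \<delta>) *\<^sub>R e) \<le> diameter (closure \<Omega>)"
      using assms(2,6) by (intro diameter_bounded_bound) auto
    then have "norm (2 *\<^sub>R v - (2 * \<delta>) *\<^sub>R e) \<le> 2 * L"
      using diam assms(2) by (simp add: diameter_closure dist_norm ab algebra_simps flip: scaleR_2)
    then have "(norm (2 *\<^sub>R v - (2 * \<delta>) *\<^sub>R e))\<^sup>2 \<le> (2 * L)\<^sup>2" by (rule power_mono) simp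
    moreover have "(norm (2 *\<^sub>R v - (2 * \<delta>) *\<^sub>R e))\<^sup>2 = (2 * L)\<^sup>2 + (2 * \<delta>)\<^sup>2"
      unfolding power2_norm_eq_inner
      by (simp add: inner_diff_left inner_diff_right vv ee ev power2_eq_square)
    ultimately show ?thesis by simp
  qed
  have refl_snd: "(s, - t) \<in> W" if "(s, t) \<in> W" for s t
  proof -
    have "reflection q e (T (s, t)) \<in> \<Omega>"
      using assms(11) that unfolding symmetric_about_def W_def by auto
    moreover have "reflection q e (T (s, t)) = T (s, - t)"
      by (simp add: refle \<open>\<delta> = 0\<close> T_def inner_add_left ev ee algebra_simps flip: scaleR_2)
    ultimately show ?thesis by (simp add: W_def)
  qed

  have openW: "open W" unfolding W_def by (rule open_vimage[OF assms(3) contT])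
  \<comment> \<open>A point and its mirror images have distances \<open>2 |s| L\<close> and \<open>2 |t| L\<close>, which are at most the
    diameter \<open>2 L\<close>.\<close>
  have abs_le: "\<bar>s\<bar> \<le> 1 \<and> \<bar>t\<bar> \<le> 1" if st: "(s, t) \<in> W" for s t
  proof -
    have "dist (T (s, t)) (T (- s, t)) \<le> 2 * L" "dist (T (s, t)) (T (s, - t)) \<le> 2 * L"
      using diameter_bounded_bound[OF assms(2)] st refl_fst[OF st] refl_snd[OF st]
      by (auto simp: W_def diam)
    moreover have "dist (T (s, t)) (T (- s, t)) = \<bar>2 * s\<bar> * L"
      by (simp add: dT L_def)
    moreover have "dist (T (s, t)) (T (s, - t)) = \<bar>2 * t\<bar> * L"
    proof -
      have "dist (T (s, t)) (T (s, - t)) = norm ((2 * t) *\<^sub>R (L *\<^sub>R e))" by (simp add: dT)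
      then show ?thesis using L(1) assms(8) unfolding norm_scaleR by simp
    qed
    ultimately have "\<bar>2 * s\<bar> \<le> 2" "\<bar>2 * t\<bar> \<le> 2" using L(1) by (simp_all only: mult_le_cancel_right_pos)
    then show ?thesis by linarith
  qed
  have nbhd: "\<exists>d>0. (s + d, t) \<in> W \<and> (s - d, t) \<in> W \<and> (s, t + d) \<in> W" if st: "(s, t) \<in> W" for s t
  proof -
    obtain r where r: "0 < r" "ball (s, t) r \<subseteq> W" using openE[OF openW st] .
    have "(s + r/2, t) \<in> ball (s, t) r" "(s - r/2, t) \<in> ball (s, t) r" "(s, t + r/2) \<in> ball (s, t) r"
      using r(1) by (simp_all add: dist_Pair_Pair dist_real_def)
    then show ?thesis using r by (intro exI[of _ "r/2"]) auto
  qed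
  have strip: "\<bar>s\<bar> < 1 \<and> \<bar>t\<bar> \<le> 1" if st: "(s, t) \<in> W" for s t
  proof -
    obtain d where "0 < d" "(s + d, t) \<in> W" "(s - d, t) \<in> W" using nbhd[OF st] by blast
    then show ?thesis using abs_le[of "s + d" t] abs_le[of "s - d" t] abs_le[OF st] by auto
  qed
  have boundedW: "bounded W"
    by (rule bounded_subset[OF bounded_cbox[of "(-1, -1)" "(1, 1)"]])
       (use abs_le in \<open>force simp: cbox_Pair_eq abs_le_iff\<close>)
  have comb: "u *\<^sub>R T z + w *\<^sub>R T z' = T (u *\<^sub>R z + w *\<^sub>R z')" if "u + w = 1" for u w z z'
  proof -
    have "u *\<^sub>R m + w *\<^sub>R m = m" using that by (metis scaleR_add_left scaleR_one)
    then have "T (u *\<^sub>R z + w *\<^sub>R z') = (u *\<^sub>R m + w *\<^sub>R m) + fst (u *\<^sub>R z + w *\<^sub>R z') *\<^sub>R v + snd (u *\<^sub>R z + w *\<^sub>R z') *\<^sub>R (L *\<^sub>R e)"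
      by (simp add: T_def)
    then show ?thesis by (simp add: T_def algebra_simps)
  qed
  have convexW: "convex W"
    unfolding W_def by (rule convexI) (use convexD[OF assms(4)] comb in \<open>auto simp: comb[symmetric]\<close>)
  have star: "(1 - r * (1 - s), r * t) \<in> W" if st: "(s, t) \<in> W" and r: "0 < r" "r < 1" for s t r
  proof -
    have "b - r *\<^sub>R (b - T (s, t)) \<in> interior \<Omega>"
      using st r assms(3,6) by (intro mem_interior_closure_convex_shrink[OF assms(4)])
        (auto simp: W_def interior_open)
    moreover have "b - r *\<^sub>R (b - T (s, t)) = T (1 - r * (1 - s), r * t)"
      by (simp add: T_def ab(2) algebra_simps)
    ultimately show ?thesis using assms(3) by (simp add: W_def interior_open)
  qed
  have Te: "T z \<bullet> e = m \<bullet> e + L * snd z" for z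
    by (simp add: T_def inner_add_left ev ee)
  have Pe: "P \<bullet> e = m \<bullet> e + L * Y P" and PW: "P \<in> \<Omega> \<longleftrightarrow> (X P, Y P) \<in> W" for P
    using Te[of "(X P, Y P)"] by (simp_all add: TXY W_def)
  define H where "H = width \<Omega> e / diameter \<Omega>"
  have width_ge: "2 * L * t \<le> width \<Omega> e" if st: "(s, t) \<in> W" for s t
  proof -
    have "T (s, t) \<in> \<Omega>" "T (s, - t) \<in> \<Omega>" using st refl_snd[OF st] by (auto simp: W_def)
    moreover have le: "m \<bullet> e - L \<le> P \<bullet> e" "P \<bullet> e \<le> m \<bullet> e + L" if "P \<in> \<Omega>" for P
    proof -
      have "\<bar>L * Y P\<bar> \<le> L" using abs_le[of "X P" "Y P"] that L by (simp add: PW abs_mult)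
      then show "m \<bullet> e - L \<le> P \<bullet> e" "P \<bullet> e \<le> m \<bullet> e + L" unfolding Pe[of P] by linarith+
    qed
    moreover have "bdd_above ((\<lambda>x. x \<bullet> e) ` \<Omega>)" by (rule bdd_aboveI2) (rule le(2))
    moreover have "bdd_below ((\<lambda>x. x \<bullet> e) ` \<Omega>)" by (rule bdd_belowI2) (rule le(1))
    ultimately have "T (s, t) \<bullet> e \<le> (SUP x\<in>\<Omega>. x \<bullet> e)" "(INF x\<in>\<Omega>. x \<bullet> e) \<le> T (s, - t) \<bullet> e"
      by (auto intro: cSUP_upper cINF_lower)
    then show ?thesis by (simp add: width_def Te)
  qed
  have width_le: "width \<Omega> e \<le> 2 * L * t" if le: "\<And>s t'. (s, t') \<in> W \<Longrightarrow> t' \<le> t" for t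
  proof -
    have "Y P \<le> t" "- t \<le> Y P" if P: "P \<in> \<Omega>" for P
      using le[of "X P" "Y P"] le[of "X P" "- Y P"] refl_snd[of "X P" "Y P"] P
      by (simp_all add: PW)
    then have bound: "P \<bullet> e \<le> m \<bullet> e + L * t" "m \<bullet> e + L * (- t) \<le> P \<bullet> e" if "P \<in> \<Omega>" for P
      unfolding Pe[of P] using that L(1) by (simp_all only: add_le_cancel_left mult_le_cancel_left_pos)
    have "(SUP x\<in>\<Omega>. x \<bullet> e) \<le> m \<bullet> e + L * t"
      by (rule cSUP_least[OF assms(1)]) (rule bound(1))
    moreover have "m \<bullet> e + L * (- t) \<le> (INF x\<in>\<Omega>. x \<bullet> e)"
      by (rule cINF_greatest[OF assms(1)]) (rule bound(2))
    ultimately show ?thesis by (simp add: width_def)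
  qed
  obtain s0 t0 where st0: "(s0, t0) \<in> W" "0 < t0"
  proof -
    obtain P where "P \<in> \<Omega>" using assms(1) by auto
    then have P: "(X P, Y P) \<in> W" by (simp add: PW)
    then have "(X P, \<bar>Y P\<bar>) \<in> W" using refl_snd[OF P] by (cases "0 \<le> Y P") auto
    from nbhd[OF this] obtain d where "0 < d" "(X P, \<bar>Y P\<bar> + d) \<in> W" by blast
    then show ?thesis by (intro that[of "X P" "\<bar>Y P\<bar> + d"]) auto
  qed
  have "0 < H" unfolding H_def diam using width_ge[OF st0(1)] st0(2) L
    by (smt (verit) divide_pos_pos mult_pos_pos)
  interpret normalized_domain W H
  proof unfold_locales
    show "\<exists>s t'. (s, t') \<in> W \<and> t < t'" if "t < H" for t
    proof (rule ccontr)
      assume "\<not> (\<exists>s t'. (s, t') \<in> W \<and> t < t')"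
      then have "width \<Omega> e \<le> 2 * L * t" by (intro width_le) (meson not_le)
      then have "H \<le> t" using L by (simp add: H_def diam divide_le_eq mult.commute)
      then show False using that by simp
    qed
  qed (use openW convexW boundedW strip refl_fst refl_snd star \<open>0 < H\<close> in auto)

  \<comment> \<open>The trial function in the original coordinates, and its gradient.\<close>
  define u where "u P = profile (X P) * (1 - (Y P)\<^sup>2/3)" for P
  define g where "g P = (dprofile (X P) * (1 - (Y P)\<^sup>2/3) / L\<^sup>2) *\<^sub>R v
      - (2/3 * Y P * profile (X P) / L) *\<^sub>R e" for P
  have contX: "continuous_on UNIV X" and contY: "continuous_on UNIV Y"
    unfolding X_def Y_def using L by (intro continuous_intros; simp)+
  have contg: "continuous_on UNIV g"
    unfolding g_def using L
    by (intro continuous_intros contX contY continuous_on_compose2[OF continuous_profile contX]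
        continuous_on_compose2[OF continuous_dprofile contX]; simp)
  have contu: "continuous_on UNIV u"
    unfolding u_def
    by (intro continuous_intros contY continuous_on_compose2[OF continuous_profile contX]; simp)
  have deru: "(u has_derivative (\<lambda>h. g P \<bullet> h)) (at P)" for P
  proof -
    have inner: "((\<lambda>P. (P - m) \<bullet> x) has_derivative (\<lambda>h. h \<bullet> x)) (at P)" for x
      by (auto intro!: derivative_eq_intros)
    have dX: "(X has_derivative (\<lambda>h. (h \<bullet> v) / L\<^sup>2)) (at P)"
      and dY: "(Y has_derivative (\<lambda>h. (h \<bullet> e) / L)) (at P)"
      unfolding X_def Y_def by (rule bounded_linear.has_derivative[OF bounded_linear_divide inner])+
    have 1: "((\<lambda>P. profile (X P)) has_derivative (\<lambda>h. dprofile (X P) * ((h \<bullet> v) / L\<^sup>2))) (at P)"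
      by (rule has_derivative_compose[OF dX DERIV_profile[unfolded has_field_derivative_def]])
    have "((\<lambda>y. 1 - y\<^sup>2/3) has_real_derivative - (2/3 * y)) (at y)" for y :: real
      by (auto intro!: derivative_eq_intros)
    then have 2: "((\<lambda>P. 1 - (Y P)\<^sup>2/3) has_derivative (\<lambda>h. - (2/3 * Y P) * ((h \<bullet> e) / L))) (at P)"
      unfolding has_field_derivative_def by (rule has_derivative_compose[OF dY])
    have "g P \<bullet> h = profile (X P) * (- (2/3 * Y P) * ((h \<bullet> e) / L))
        + dprofile (X P) * ((h \<bullet> v) / L\<^sup>2) * (1 - (Y P)\<^sup>2/3)" for h
    proof -
      have "g P \<bullet> h = (dprofile (X P) * (1 - (Y P)\<^sup>2/3) / L\<^sup>2) * (h \<bullet> v)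
          - (2/3 * Y P * profile (X P) / L) * (h \<bullet> e)"
        unfolding g_def inner_diff_left inner_scaleR_left inner_commute[of v h] inner_commute[of e h] ..
      then show ?thesis by (simp only:) (simp add: mult_ac)
    qed
    then show ?thesis
      unfolding u_def [abs_def]
      by (intro has_derivative_eq_rhs[OF has_derivative_mult[OF 1 2]]) (simp add: fun_eq_iff)
  qed
  have norm_g: "(norm (g P))\<^sup>2 = ((dprofile (X P))\<^sup>2 * (1 - (Y P)\<^sup>2/3)\<^sup>2
      + 4/9 * (Y P)\<^sup>2 * (profile (X P))\<^sup>2) / L\<^sup>2" for P
  proof -
    have "(norm (\<alpha> *\<^sub>R v - \<beta> *\<^sub>R e))\<^sup>2 = \<alpha>\<^sup>2 * L\<^sup>2 + \<beta>\<^sup>2" for \<alpha> \<beta>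
      unfolding power2_norm_eq_inner
      by (simp add: inner_diff_left inner_diff_right vv ee ev power2_eq_square algebra_simps)
    then show ?thesis
      using L by (simp add: g_def power_mult_distrib power_divide power2_eq_square field_simps)
  qed
  have [measurable]: "\<Omega> \<in> sets borel" "u \<in> borel_measurable borel" "g \<in> borel_measurable borel"
    using assms(3) contu contg by (simp_all add: borel_measurable_continuous_onI)
  have "v \<bullet> (L *\<^sub>R e) = 0" "L *\<^sub>R e \<noteq> 0" using L(1) ev assms(8) by auto
  then obtain K where K: "0 < K" "\<And>f :: real ^ 2 \<Rightarrow> real. f \<in> borel_measurable borel \<Longrightarrow>
      integral\<^sup>L lborel f = K * (\<integral>z. f (T z) \<partial>lborel)"
    unfolding T_def using integral_orthogonal_coordinates[of v "L *\<^sub>R e" m] L(2) by blast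
  have ind: "indicator \<Omega> (T z) = (indicator W z :: real)" for z by (simp add: W_def indicator_def)
  define U where "U z = profile (fst z) * (1 - (snd z)\<^sup>2/3)" for z :: "real \<times> real"
  have uT: "u (T z) = U z" for z by (simp add: u_def U_def XT YT)
  have mean: "(\<integral>P. indicator \<Omega> P * u P \<partial>lborel) = 0"
  proof -
    have "(\<integral>P. indicator \<Omega> P * u P \<partial>lborel) = K * (\<integral>z. indicator W z * U z \<partial>lborel)"
      by (subst K(2)) (simp_all add: ind uT)
    moreover have "(\<integral>z. indicator W z * U z \<partial>lborel) = 0"
    proof -
      have "continuous_on UNIV U" unfolding U_def
        by (intro continuous_intros continuous_on_compose2[OF continuous_profile]; simp)
      then have m: "(\<lambda>z. indicator W z * U z) \<in> borel_measurable borel"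
        using openW by (intro borel_measurable_times borel_measurable_indicator borel_measurable_continuous_onI) auto
      have "indicator W (- fst z, snd z) * U (- fst z, snd z) = - (indicator W z * U z)" for z
      proof -
        have "(- fst z, snd z) \<in> W \<longleftrightarrow> z \<in> W"
          using refl_fst[of "fst z" "snd z"] refl_fst[of "- fst z" "snd z"] by auto
        then show ?thesis by (simp add: U_def profile_def sgn_minus indicator_def)
      qed
      then show ?thesis using integral_reflect_fst[OF m] by simp
    qed
    ultimately show ?thesis by simp
  qed
  have half: "(1/2, 0) \<in> W" using \<open>0 < H\<close> by (intro rhombus) auto
  have T_half: "T (1/2, 0) \<in> \<Omega>" using half by (simp add: W_def)
  have "0 < bessel_sq (first_zero * (1/2)\<^sup>2)" using first_zero(1) by (intro first_zero(4)) (auto simp: power2_eq_square)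
  then have u_half: "u (T (1/2, 0)) \<noteq> 0" by (simp add: uT U_def profile_def)
  define num where "num z = (dprofile (fst z))\<^sup>2 * (1 - (snd z)\<^sup>2/3)\<^sup>2
      + 4/9 * (snd z)\<^sup>2 * (profile (fst z))\<^sup>2" for z :: "real \<times> real"
  define N where "N = (\<integral>z. indicator W z * num z \<partial>lborel)"
  define M where "M = (\<integral>z. indicator W z * (U z)\<^sup>2 \<partial>lborel)"
  have den_eq: "(\<integral>P. indicator \<Omega> P * (u P)\<^sup>2 \<partial>lborel) = K * M"
    unfolding M_def by (subst K(2)) (simp_all add: ind uT)
  have num_eq: "(\<integral>P. indicator \<Omega> P * (norm (g P))\<^sup>2 \<partial>lborel) = K * (N / L\<^sup>2)"
  proof -
    have "(\<integral>P. indicator \<Omega> P * (norm (g P))\<^sup>2 \<partial>lborel) = K * (\<integral>z. indicator W z * (norm (g (T z)))\<^sup>2 \<partial>lborel)"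
      by (subst K(2)) (simp_all add: ind)
    also have "(\<lambda>z. indicator W z * (norm (g (T z)))\<^sup>2) = (\<lambda>z. (indicator W z * num z) / L\<^sup>2)"
      by (simp add: fun_eq_iff norm_g XT YT num_def)
    finally show ?thesis by (simp add: N_def)
  qed
  note test = neumann_mu1_test_function[OF assms(3,2) deru contg mean T_half u_half, unfolded den_eq num_eq]
  have M: "0 < M" using test(1) K(1) by (simp add: zero_less_mult_iff)
  have mu_le: "neumann_mu1 \<Omega> \<le> N / L\<^sup>2 / M" using test(2) K(1) by simp
  define c where "c = 4 * first_zero - 0.027 * H\<^sup>2"
  have "N - c * M \<le> 0"
  proof -
    have cp: "continuous_on UNIV (\<lambda>z :: real \<times> real. profile (fst z))"
      "continuous_on UNIV (\<lambda>z :: real \<times> real. dprofile (fst z))"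
      by (auto intro!: continuous_on_compose2[OF continuous_profile]
          continuous_on_compose2[OF continuous_dprofile] continuous_intros)
    have Wb: "W \<in> sets borel" using openW by simp
    have "integrable lborel (\<lambda>z. indicator W z * num z)" "integrable lborel (\<lambda>z. indicator W z * (U z)\<^sup>2)"
      unfolding num_def U_def
      by (intro integrable_bounded_set Wb boundedW continuous_intros cp; simp)+
    then have "N - c * M = (\<integral>z. indicator W z * num z - c * (indicator W z * (U z)\<^sup>2) \<partial>lborel)"
      by (simp add: N_def M_def)
    also have "\<dots> = (\<integral>z. indicator W z * excess z \<partial>lborel)"
    proof (rule arg_cong[where f = "integral\<^sup>L lborel"], rule ext)
      show "indicator W z * num z - c * (indicator W z * (U z)\<^sup>2) = indicator W z * excess z" for z
        by (cases "z \<in> W") (simp_all add: excess_def num_def U_def c_def power_mult_distrib)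
    qed
    finally show ?thesis using integral_excess by simp
  qed
  then have "N / L\<^sup>2 / M \<le> c / L\<^sup>2"
    using M L(1) by (simp add: divide_le_eq)
  with mu_le have "neumann_mu1 \<Omega> \<le> c / L\<^sup>2" by (rule order.trans)
  then have "L\<^sup>2 * neumann_mu1 \<Omega> \<le> c"
    using L(1) by (simp add: pos_le_divide_eq mult.commute)
  then have "(2 * L)\<^sup>2 * neumann_mu1 \<Omega> \<le> 4 * c" by (simp add: power_mult_distrib)
  also have "4 * c = 4 * j01\<^sup>2 - 0.108 * ((width \<Omega> e)\<^sup>2 / (diameter \<Omega>)\<^sup>2)"
    by (simp add: c_def first_zero_def H_def power_divide)
  finally show ?thesis by (simp only: diam)
qed

end
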